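(* Let $m\le n$ be positive integers and let $r$ be a non-negative integer with $r\leq m\leq n$. Let $\mathcal{M}_{m,n}$ be the space of real $m\times n$ matrices with the Frobenius inner product $\langle A,B\rangle=\mathrm{Tr}(A^{\mathsf T}B)$. Then the smooth semialgebraic set $\mathcal{M}_{m,n,r}=\{A\in \mathcal{M}_{m,n} : \mathrm{rank}(A)=r\}$ is a minimal submanifold of the Euclidean space $(\mathcal{M}_{m,n},\langle\cdot,\cdot\rangle)$.
   Context: A (smooth, embedded, not necessarily closed) submanifold $X$ of a Riemannian manifold $(M,g)$ is called minimal if its mean curvature vector field $H$ is identically zero. Here $H$ is the trace with respect to the induced metric of the second fundamental form $b(\xi,\eta)=(\nabla_\xi\vec\eta)^\perp$ of $X$, where $\nabla$ is the Levi-Civita connection of $M$, $\vec\eta$ is a local vector field extending $\eta$ that is tangent to $X$ along $X$, and $\perp$ denotes the component normal to $X$. In a local frame $e^1,\dots,e^k$ of $TX$ with Gram matrix $G=(g(e^i,e^j))$, $H=\sum_{i,j}(G^{-1})_{ij}\,b(e^i,e^j)$. *)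

theory Defs
  imports "HOL-Analysis.Analysis"
begin

lemma inner_matrix_eq_frobenius:
  fixes A B :: "real^'n^'m"
  shows "A \<bullet> B = trace (transpose A ** B)"
  unfolding inner_vec_def trace_def transpose_def matrix_matrix_mult_def
  by (simp, rule sum.swap)

inductive semialgebraic :: "'a::euclidean_space set \<Rightarrow> bool" where
  zero: "real_polynomial_function p \<Longrightarrow> semialgebraic {x. p x = 0}"
| positive: "real_polynomial_function p \<Longrightarrow> semialgebraic {x. p x > 0}"
| union: "semialgebraic S \<Longrightarrow> semialgebraic T \<Longrightarrow> semialgebraic (S \<union> T)"
| complement: "semialgebraic S \<Longrightarrow> semialgebraic (- S)"

text \<open>The notions \<open>C_on\<close> and \<open>smooth_on\<close> are meant for open sets \<open>S\<close> only.\<close>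

primrec C_on :: "nat \<Rightarrow> 'a::euclidean_space set \<Rightarrow> ('a \<Rightarrow> 'b::euclidean_space) \<Rightarrow> bool" where
  "C_on 0 S f \<longleftrightarrow> continuous_on S f"
| "C_on (Suc k) S f \<longleftrightarrow>
     f differentiable_on S \<and> (\<forall>v. C_on k S (\<lambda>x. frechet_derivative f (at x) v))"

definition smooth_on :: "'a::euclidean_space set \<Rightarrow> ('a \<Rightarrow> 'b::euclidean_space) \<Rightarrow> bool" where
  "smooth_on S f \<longleftrightarrow> (\<forall>k. C_on k S f)"

definition diffeomorphism_on ::
  "'a::euclidean_space set \<Rightarrow> 'b::euclidean_space set \<Rightarrow> ('a \<Rightarrow> 'b) \<Rightarrow> bool" where
  "diffeomorphism_on U V \<phi> \<longleftrightarrow> open U \<and> open V \<and> smooth_on U \<phi> \<and> \<phi> ` U = V \<and>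
     (\<exists>\<psi>. smooth_on V \<psi> \<and> (\<forall>x\<in>U. \<psi> (\<phi> x) = x) \<and> (\<forall>y\<in>V. \<phi> (\<psi> y) = y))"

text \<open>Slice charts are modelled on an arbitrary \<open>k\<close>-dimensional linear subspace \<open>L\<close> of the
  ambient space in place of \<open>\<real>\<^sup>k \<times> {0}\<close>. The set \<open>X\<close> need not be closed.\<close>

definition embedded_submanifold :: "nat \<Rightarrow> 'a::euclidean_space set \<Rightarrow> bool" where
  "embedded_submanifold k X \<longleftrightarrow>
     (\<forall>p\<in>X. \<exists>U V (L::'a set) \<phi>. p \<in> U \<and> diffeomorphism_on U V \<phi> \<and>
        subspace L \<and> dim L = k \<and> \<phi> ` (U \<inter> X) = V \<inter> L)"

definition tangent_space :: "'a::euclidean_space set \<Rightarrow> 'a \<Rightarrow> 'a set" where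
  "tangent_space X p = {v. \<exists>\<epsilon>>0. \<exists>\<gamma>::real \<Rightarrow> 'a. smooth_on {-\<epsilon><..<\<epsilon>} \<gamma> \<and>
     \<gamma> ` {-\<epsilon><..<\<epsilon>} \<subseteq> X \<and> \<gamma> 0 = p \<and> (\<gamma> has_vector_derivative v) (at 0)}"

definition normal_component :: "'a::euclidean_space set \<Rightarrow> 'a \<Rightarrow> 'a" where
  "normal_component T v = (THE w. w \<in> orthogonal_comp T \<and> v - w \<in> T)"

text \<open>The Levi-Civita connection of a Euclidean space is the componentwise directional
  derivative.\<close>

definition euclidean_connection ::
  "'a::euclidean_space \<Rightarrow> ('a \<Rightarrow> 'a) \<Rightarrow> 'a \<Rightarrow> 'a" where
  "euclidean_connection \<xi> Y p = frechet_derivative Y (at p) \<xi>"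

definition tangent_extension ::
  "'a::euclidean_space set \<Rightarrow> 'a \<Rightarrow> 'a \<Rightarrow> ('a \<Rightarrow> 'a) \<Rightarrow> bool" where
  "tangent_extension X p \<eta> Y \<longleftrightarrow>
     (\<exists>U. open U \<and> p \<in> U \<and> smooth_on U Y \<and> (\<forall>x\<in>U \<inter> X. Y x \<in> tangent_space X x)) \<and> Y p = \<eta>"

text \<open>On a submanifold, the value for \<open>\<xi>, \<eta> \<in> tangent_space X p\<close> does not depend on the
  extension of \<open>\<eta>\<close>; the definite description commits to this.\<close>

definition second_fundamental_form :: "'a::euclidean_space set \<Rightarrow> 'a \<Rightarrow> 'a \<Rightarrow> 'a \<Rightarrow> 'a" where
  "second_fundamental_form X p \<xi> \<eta> =
     (THE w. \<exists>Y. tangent_extension X p \<eta> Y \<and>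
        w = normal_component (tangent_space X p) (euclidean_connection \<xi> Y p))"

definition frame_of :: "'a::euclidean_space set \<Rightarrow> 'a set \<Rightarrow> bool" where
  "frame_of T E \<longleftrightarrow> E \<subseteq> T \<and> independent E \<and> span E = T"

text \<open>A frame is indexed by its own elements, so its Gram matrix is \<open>\<lambda>e f. e \<bullet> f\<close>.\<close>

definition inverse_gram :: "'a::euclidean_space set \<Rightarrow> ('a \<Rightarrow> 'a \<Rightarrow> real) \<Rightarrow> bool" where
  "inverse_gram E G' \<longleftrightarrow>
     (\<forall>e\<in>E. \<forall>f\<in>E. (\<Sum>h\<in>E. (e \<bullet> h) * G' h f) = (if e = f then 1 else 0))"

text \<open>The trace of the second fundamental form, which is the same in every frame of the tangent
  space. It is tensorial, so the frame is only needed at the point \<open>p\<close>.\<close>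

definition mean_curvature :: "'a::euclidean_space set \<Rightarrow> 'a \<Rightarrow> 'a" where
  "mean_curvature X p =
     (THE H. \<exists>E G'. frame_of (tangent_space X p) E \<and> inverse_gram E G' \<and>
        H = (\<Sum>e\<in>E. \<Sum>f\<in>E. G' e f *\<^sub>R second_fundamental_form X p e f))"

definition minimal_submanifold :: "'a::euclidean_space set \<Rightarrow> bool" where
  "minimal_submanifold X \<longleftrightarrow>
     (\<exists>k. embedded_submanifold k X) \<and> (\<forall>p\<in>X. mean_curvature X p = 0)"

definition rank_stratum :: "nat \<Rightarrow> (real^'n^'m) set" where
  "rank_stratum r = {A. rank A = r}"

end

theory Submission
  imports Defs
begin

text \<open>
  Minimality rests on a symmetry. Let \<open>A\<close> have rank \<open>r\<close>, let \<open>P\<close> be the orthogonal projection onto its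
  column space, and let \<open>R X = (2 P - 1) X\<close>. This linear isometry maps the stratum to itself and fixes \<open>A\<close>. The
  normal space of the stratum at \<open>A\<close> consists of the matrices that vanish on the row space and take values
  orthogonal to the column space, so \<open>R\<close> acts on it as \<open>-1\<close>. The mean curvature vector at \<open>A\<close> is normal and is
  preserved by \<open>R\<close>, hence it equals its own negative.

  In the proof, this argument is applied to the second fundamental form. With \<open>A'\<close> the Moore-Penrose inverse
  of \<open>A\<close>, \<open>normal_part_derivative\<close> and \<open>second_fundamental_form_eq\<close> identify that form as the normal part of
  \<open>\<xi> A' \<eta> + \<eta> A' \<xi>\<close>, whatever tangent extension is used. This expression is bilinear, and \<open>R\<close> reverses its sign.
  Its trace is independent of the frame (\<open>sum_inverse_gram_eq_sum_orthonormal\<close>), so replacing an orthonormal basis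
  by its image under \<open>R\<close> shows that the trace is zero (\<open>mean_curvature_eq_0_if_reflection\<close>).

  The stratum is a submanifold because, in the block form given by the column space and the row space of \<open>A\<close>, a
  matrix \<open>X\<close> near \<open>A\<close> has the rank of \<open>A\<close> if and only if the Schur complement \<open>X\<^sub>2\<^sub>2 - X\<^sub>2\<^sub>1 X\<^sub>1\<^sub>1\<^sup>-\<^sup>1 X\<^sub>1\<^sub>2\<close> vanishes
  (\<open>rank_eq_iff_normal_part\<close>). Replacing \<open>X\<^sub>2\<^sub>2\<close> by this complement is a shear, hence a diffeomorphism, and it carries
  the stratum to the tangent space \<open>X\<^sub>2\<^sub>2 = 0\<close> (\<open>chart_straightens\<close>). The dimension of that space depends only on the
  rank (\<open>dim_tangent_eq\<close>).

  The stratum is semialgebraic because the rank is the largest size of an independent family of rows, and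
  independence is detected by a Gram determinant, which is a polynomial (\<open>semialgebraic_rank_stratum\<close>).
\<close>

section \<open>Calculus of the smoothness predicates\<close>

lemma C_on_cong_imp:
  assumes "open S" "\<And>x. x \<in> S \<Longrightarrow> f x = g x" "C_on k S f"
  shows "C_on k S g"
  using assms(2,3)
proof (induction k arbitrary: f g)
  case 0
  show ?case
    unfolding C_on.simps
    by (rule continuous_on_eq[OF 0(2)[unfolded C_on.simps] 0(1)])
next
  case (Suc k)
  have diff: "f differentiable (at x)" if "x \<in> S" for x
    using Suc.prems(2) that \<open>open S\<close> by (auto simp: differentiable_on_eq_differentiable_at)
  have eq: "frechet_derivative f (at x) = frechet_derivative g (at x)" if "x \<in> S" for x
    by (rule frechet_derivative_transform_within_open[OF diff[OF that] \<open>open S\<close> that])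
      (simp add: Suc.prems(1))
  have "g differentiable (at x)" if "x \<in> S" for x
    using diff[OF that] has_derivative_transform_within_open[OF _ \<open>open S\<close> that] Suc.prems(1)
    unfolding differentiable_def by metis
  then have "g differentiable_on S"
    using \<open>open S\<close> by (simp add: differentiable_on_eq_differentiable_at)
  moreover have "C_on k S (\<lambda>x. frechet_derivative g (at x) v)" for v
    by (rule Suc.IH[where f = "\<lambda>x. frechet_derivative f (at x) v"])
      (use Suc.prems(2) eq in auto)
  ultimately show ?case by simp
qed

lemma C_on_SucI:
  assumes "open S" "\<And>x. x \<in> S \<Longrightarrow> (f has_derivative f' x) (at x)"
    and "\<And>v. C_on k S (\<lambda>x. f' x v)"
  shows "C_on (Suc k) S f"
proof -
  have "f differentiable_on S"
    using assms(1,2) by (auto simp: differentiable_on_eq_differentiable_at differentiable_def)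
  moreover have "C_on k S (\<lambda>x. frechet_derivative f (at x) v)" for v
    by (rule C_on_cong_imp[OF assms(1) _ assms(3)[of v]])
      (simp add: frechet_derivative_at[OF assms(2), symmetric])
  ultimately show ?thesis by simp
qed

lemma C_on_Suc_has_derivative:
  assumes "open S" "C_on (Suc k) S f" "x \<in> S"
  shows "(f has_derivative frechet_derivative f (at x)) (at x)"
  using assms frechet_derivative_works by (auto simp: differentiable_on_eq_differentiable_at)

lemma C_on_SucD: "C_on (Suc k) S f \<Longrightarrow> C_on k S f"
proof (induction k arbitrary: f)
  case 0
  then show ?case by (simp add: differentiable_imp_continuous_on)
next
  case (Suc k)
  then show ?case by (metis C_on.simps(2))
qed

lemma C_on_const: "open S \<Longrightarrow> C_on k S (\<lambda>x. c)"
proof (induction k arbitrary: c)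
  case (Suc k)
  show ?case
    by (rule C_on_SucI[OF Suc.prems has_derivative_const Suc.IH[OF Suc.prems]])
qed simp

lemma C_on_bounded_linear:
  assumes "open S" "bounded_linear f"
  shows "C_on k S f"
proof (cases k)
  case 0
  then show ?thesis by (simp add: assms linear_continuous_on)
next
  case (Suc j)
  show ?thesis unfolding Suc
    by (rule C_on_SucI[OF assms(1) bounded_linear_imp_has_derivative[OF assms(2)]
          C_on_const[OF assms(1)]])
qed

lemma C_on_add:
  assumes "open S"
  shows "C_on k S f \<Longrightarrow> C_on k S g \<Longrightarrow> C_on k S (\<lambda>x. f x + g x)"
proof (induction k arbitrary: f g)
  case 0
  then show ?case by (simp add: continuous_on_add)
next
  case (Suc k)
  show ?case
    by (rule C_on_SucI[OF assms has_derivative_add[OF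
          C_on_Suc_has_derivative[OF assms Suc.prems(1)]
          C_on_Suc_has_derivative[OF assms Suc.prems(2)]] Suc.IH])
      (use Suc.prems in auto)
qed

text \<open>The Leibniz rule expresses the derivative of the product through products of functions that
  are one degree less smooth than the factors, at worst; this is why the factors are also used at
  the lower degree.\<close>

lemma C_on_bilinear:
  assumes "open S" "bounded_bilinear h"
  shows "C_on k S f \<Longrightarrow> C_on k S g \<Longrightarrow> C_on k S (\<lambda>x. h (f x) (g x))"
proof (induction k arbitrary: f g)
  case 0
  then show ?case using bounded_bilinear.continuous_on[OF assms(2)] by simp
next
  case (Suc k)
  show ?case
    by (rule C_on_SucI[OF assms(1) bounded_bilinear.FDERIV[OF assms(2)
          C_on_Suc_has_derivative[OF assms(1) Suc.prems(1)]
          C_on_Suc_has_derivative[OF assms(1) Suc.prems(2)]]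
          C_on_add[OF assms(1) Suc.IH Suc.IH]])
      (use Suc.prems C_on_SucD in auto)
qed

text \<open>The derivative of a reciprocal is again built from the reciprocal, so the induction closes.\<close>

lemma C_on_inverse:
  fixes f :: "'a::euclidean_space \<Rightarrow> real"
  assumes "open S" "\<And>x. x \<in> S \<Longrightarrow> f x \<noteq> 0"
  shows "C_on k S f \<Longrightarrow> C_on k S (\<lambda>x. inverse (f x))"
proof (induction k)
  case 0
  then show ?case using assms(2) by (auto intro: continuous_on_inverse)
next
  case (Suc k)
  let ?D = "\<lambda>x. frechet_derivative f (at x)"
  have IH: "C_on k S (\<lambda>x. inverse (f x))"
    by (rule Suc.IH[OF C_on_SucD[OF Suc.prems]])
  show ?case
  proof (rule C_on_SucI[OF assms(1)])
    fix x assume "x \<in> S"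
    show "((\<lambda>x. inverse (f x)) has_derivative
        (\<lambda>v. (-1) * (inverse (f x) * (?D x v * inverse (f x))))) (at x)"
      using Deriv.has_derivative_inverse[OF assms(2)[OF \<open>x \<in> S\<close>]
          C_on_Suc_has_derivative[OF assms(1) Suc.prems \<open>x \<in> S\<close>]]
      by (simp add: mult.assoc)
  next
    fix v
    have D: "C_on k S (\<lambda>x. ?D x v)" using Suc.prems by simp
    show "C_on k S (\<lambda>x. (-1) * (inverse (f x) * (?D x v * inverse (f x))))"
      by (intro C_on_bilinear[OF assms(1) bounded_bilinear_mult] C_on_const[OF assms(1)] IH D)
  qed
qed

lemma C_on_sum:
  assumes "open S" "finite I" "\<And>i. i \<in> I \<Longrightarrow> C_on k S (f i)"
  shows "C_on k S (\<lambda>x. \<Sum>i\<in>I. f i x)"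
  using assms(2,3)
  by (induction I rule: finite_induct) (auto intro: C_on_const C_on_add assms(1))

text \<open>All curves, vector fields and chart ingredients below are polynomial, up to division by one
  determinant. Thus this lemma and the one on reciprocals supply every smoothness claim.\<close>

lemma smooth_on_polynomial_function:
  fixes f :: "'a::euclidean_space \<Rightarrow> 'b::euclidean_space"
  assumes "open S" "polynomial_function f"
  shows "smooth_on S f"
proof -
  have real: "C_on k S p" if "real_polynomial_function p" for k and p :: "'a \<Rightarrow> real"
    using that
    by (induction rule: real_polynomial_function.induct)
      (auto intro: C_on_bounded_linear C_on_const C_on_add assms(1)
        C_on_bilinear[OF assms(1) bounded_bilinear_mult])
  have "C_on k S (\<lambda>x. \<Sum>b\<in>Basis. (f x \<bullet> b) *\<^sub>R b)" for k
    using assms(2) unfolding polynomial_function_iff_Basis_inner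
    by (intro C_on_sum[OF assms(1)] C_on_bilinear[OF assms(1) bounded_bilinear_scaleR]
        C_on_const[OF assms(1)] real) auto
  then show ?thesis by (simp add: smooth_on_def euclidean_representation)
qed

lemma smooth_on_add:
  "open S \<Longrightarrow> smooth_on S f \<Longrightarrow> smooth_on S g \<Longrightarrow> smooth_on S (\<lambda>x. f x + g x)"
  by (simp add: smooth_on_def C_on_add)

lemma smooth_on_bilinear:
  "open S \<Longrightarrow> bounded_bilinear h \<Longrightarrow> smooth_on S f \<Longrightarrow> smooth_on S g \<Longrightarrow>
    smooth_on S (\<lambda>x. h (f x) (g x))"
  by (simp add: smooth_on_def C_on_bilinear)

lemma smooth_on_imp_continuous_on: "smooth_on S f \<Longrightarrow> continuous_on S f"
  unfolding smooth_on_def by (metis C_on.simps(1))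

lemma smooth_on_imp_has_derivative:
  "open S \<Longrightarrow> smooth_on S f \<Longrightarrow> x \<in> S \<Longrightarrow> (f has_derivative frechet_derivative f (at x)) (at x)"
  using C_on_Suc_has_derivative unfolding smooth_on_def by blast

text \<open>A shear \<open>x \<mapsto> x + g x\<close> along directions in which \<open>g\<close> is constant is undone by \<open>x \<mapsto> x - g x\<close>.\<close>

lemma diffeomorphism_on_shear:
  assumes "open U" "smooth_on U g"
    and add: "\<And>x. x \<in> U \<Longrightarrow> x + g x \<in> U \<and> g (x + g x) = g x"
    and diff: "\<And>x. x \<in> U \<Longrightarrow> x - g x \<in> U \<and> g (x - g x) = g x"
  shows "diffeomorphism_on U U (\<lambda>x. x + g x)"
proof -
  have id: "smooth_on U (\<lambda>x. x)"
    by (rule smooth_on_polynomial_function[OF assms(1)]) simp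
  have "smooth_on U (\<lambda>x. (-1) *\<^sub>R g x)"
    by (intro smooth_on_bilinear[OF assms(1) bounded_bilinear_scaleR] assms(2)
        smooth_on_polynomial_function[OF assms(1)]) simp
  from smooth_on_add[OF assms(1) id this] have "smooth_on U (\<lambda>x. x - g x)" by simp
  moreover have "smooth_on U (\<lambda>x. x + g x)"
    by (rule smooth_on_add[OF assms(1) id assms(2)])
  moreover have "(\<lambda>x. x + g x) ` U = U"
  proof
    show "U \<subseteq> (\<lambda>x. x + g x) ` U"
    proof
      fix x assume "x \<in> U"
      then show "x \<in> (\<lambda>x. x + g x) ` U"
        using diff by (intro image_eqI[of _ _ "x - g x"]) auto
    qed
  qed (use add in auto)
  ultimately show ?thesis
    unfolding diffeomorphism_on_def using assms(1) add diff
    by (intro conjI exI[of _ "\<lambda>x. x - g x"]) auto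
qed

section \<open>Matrices with polynomial entries\<close>

lemma bounded_bilinear_matrix_mult:
  "bounded_bilinear ((**) :: real^'n^'m \<Rightarrow> real^'p^'n \<Rightarrow> real^'p^'m)"
proof -
  have "bilinear ((**) :: real^'n^'m \<Rightarrow> real^'p^'n \<Rightarrow> real^'p^'m)"
    unfolding bilinear_def
    by (auto intro!: linearI simp: matrix_matrix_mult_def vec_eq_iff sum.distrib
        distrib_left distrib_right sum_distrib_left mult_ac)
  then show ?thesis by (simp add: bilinear_conv_bounded_bilinear)
qed

lemmas matrix_mult_linear =
  bounded_bilinear.add_left[OF bounded_bilinear_matrix_mult]
  bounded_bilinear.add_right[OF bounded_bilinear_matrix_mult]
  bounded_bilinear.diff_left[OF bounded_bilinear_matrix_mult]
  bounded_bilinear.diff_right[OF bounded_bilinear_matrix_mult]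
  bounded_bilinear.minus_left[OF bounded_bilinear_matrix_mult]
  bounded_bilinear.minus_right[OF bounded_bilinear_matrix_mult]
  bounded_bilinear.scaleR_left[OF bounded_bilinear_matrix_mult]
  bounded_bilinear.scaleR_right[OF bounded_bilinear_matrix_mult]
  bounded_bilinear.zero_left[OF bounded_bilinear_matrix_mult]
  bounded_bilinear.zero_right[OF bounded_bilinear_matrix_mult]

lemma polynomial_function_matrix_iff:
  fixes F :: "'a::real_normed_vector \<Rightarrow> real^'n^'m"
  shows "polynomial_function F \<longleftrightarrow> (\<forall>i j. real_polynomial_function (\<lambda>x. F x $ i $ j))"
  unfolding polynomial_function_iff_Basis_inner
  by (auto simp: Basis_vec_def inner_axis)

lemma real_polynomial_function_det:
  fixes F :: "'a::real_normed_vector \<Rightarrow> real^'n^'n"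
  assumes "polynomial_function F"
  shows "real_polynomial_function (\<lambda>x. det (F x))"
  using assms unfolding det_def polynomial_function_matrix_iff
  by (intro real_polynomial_function_sum real_polynomial_function.intros(4)
      real_polynomial_function.intros(2) real_polynomial_function_prod) (auto simp: finite_permutations)

lemma polynomial_function_matrix_mult:
  fixes F :: "'a::real_normed_vector \<Rightarrow> real^'n^'m" and G :: "'a \<Rightarrow> real^'p^'n"
  assumes "polynomial_function F" "polynomial_function G"
  shows "polynomial_function (\<lambda>x. F x ** G x)"
  using assms unfolding polynomial_function_matrix_iff matrix_matrix_mult_def
  by (auto intro!: real_polynomial_function_sum real_polynomial_function.intros(4))

text \<open>By Cramer's rule, the entries of the adjugate are the determinants of the matrix with one column
  replaced by a unit vector. It serves to write the inverse as a polynomial map divided by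
  the determinant.\<close>

definition adjugate :: "real^'n^'n \<Rightarrow> real^'n^'n" where
  "adjugate A = (\<chi> k j. det (\<chi> i l. if l = k then axis j 1 $ i else A $ i $ l))"

lemma matrix_inv_mult:
  fixes A :: "real^'n^'n"
  assumes "det A \<noteq> 0"
  shows "A ** matrix_inv A = mat 1" "matrix_inv A ** A = mat 1"
  using someI_ex[of "\<lambda>A'. A ** A' = mat 1 \<and> A' ** A = mat 1"] assms
  unfolding matrix_inv_def invertible_det_nz[symmetric] invertible_def by auto

lemma matrix_inv_eq_adjugate:
  assumes "det A \<noteq> 0"
  shows "matrix_inv A = inverse (det A) *\<^sub>R adjugate A"
proof -
  have "A *v (column j (matrix_inv A)) = axis j 1" for j
  proof -
    have "matrix_inv A *v axis j 1 = column j (matrix_inv A)"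
      by (simp add: matrix_vector_mult_basis)
    then show ?thesis
      using matrix_inv_mult(1)[OF assms] by (metis matrix_vector_mul_assoc matrix_vector_mul_lid)
  qed
  then have "column j (matrix_inv A) =
      (\<chi> k. det (\<chi> i l. if l = k then axis j 1 $ i else A $ i $ l) / det A)" for j
    using cramer[OF assms] by blast
  then have "matrix_inv A $ k $ j = det (\<chi> i l. if l = k then axis j 1 $ i else A $ i $ l) / det A" for k j
    by (metis (no_types, lifting) column_def vec_lambda_beta)
  then show ?thesis by (simp add: vec_eq_iff adjugate_def divide_inverse mult.commute)
qed

lemma polynomial_function_adjugate:
  fixes F :: "'a::real_normed_vector \<Rightarrow> real^'n^'n"
  assumes "polynomial_function F"
  shows "polynomial_function (\<lambda>x. adjugate (F x))"
proof -
  have "polynomial_function (\<lambda>x. \<chi> i l. if l = k then axis j 1 $ i else F x $ i $ l)"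
    for k j :: 'n
    using assms unfolding polynomial_function_matrix_iff vec_lambda_beta
    by (intro allI, rename_tac i l, case_tac "l = k") (simp_all add: real_polynomial_function.intros(2))
  then show ?thesis
    unfolding adjugate_def
    by (subst polynomial_function_matrix_iff) (simp add: real_polynomial_function_det)
qed

lemma open_det_nonzero:
  fixes F :: "'a::real_normed_vector \<Rightarrow> real^'n^'n"
  assumes "polynomial_function F"
  shows "open {x. det (F x) \<noteq> 0}"
proof -
  have "continuous_on UNIV (\<lambda>x. det (F x))"
    using real_polynomial_function_det[OF assms]
    by (simp add: real_polynomial_function_eq continuous_on_polymonial_function)
  then show ?thesis
    by (intro open_Collect_neq) auto
qed

lemma smooth_on_matrix_inv:
  fixes F :: "'a::euclidean_space \<Rightarrow> real^'n^'n"
  assumes "polynomial_function F"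
  shows "smooth_on {x. det (F x) \<noteq> 0} (\<lambda>x. matrix_inv (F x))"
proof -
  let ?U = "{x. det (F x) \<noteq> 0}"
  note op = open_det_nonzero[OF assms]
  have "smooth_on ?U (\<lambda>x. det (F x))"
    by (rule smooth_on_polynomial_function[OF op])
      (use real_polynomial_function_det[OF assms] in \<open>simp add: real_polynomial_function_eq\<close>)
  then have inv: "smooth_on ?U (\<lambda>x. inverse (det (F x)))"
    unfolding smooth_on_def by (auto intro: C_on_inverse[OF op])
  have "smooth_on ?U (\<lambda>x. inverse (det (F x)) *\<^sub>R adjugate (F x))"
    by (intro smooth_on_bilinear[OF op bounded_bilinear_scaleR inv]
        smooth_on_polynomial_function[OF op] polynomial_function_adjugate assms)
  then show ?thesis
    unfolding smooth_on_def
    by (auto intro: C_on_cong_imp[OF op] simp: matrix_inv_eq_adjugate)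
qed

section \<open>Rank conditions are polynomial\<close>

lemma semialgebraic_finite_INT_UN:
  assumes "finite I" "\<And>i. i \<in> I \<Longrightarrow> semialgebraic (F i)"
  shows "semialgebraic (\<Inter>i\<in>I. F i)" "semialgebraic (\<Union>i\<in>I. F i)"
proof -
  have empty: "semialgebraic ({} :: 'b set)"
    using semialgebraic.zero[of "\<lambda>x. 1"] by (simp add: real_polynomial_function.intros(2))
  have Un: "semialgebraic (\<Union>i\<in>I. G i)" if "\<And>i. i \<in> I \<Longrightarrow> semialgebraic (G i)"
    for G :: "'a \<Rightarrow> 'b set"
    using assms(1) that
    by (induction I rule: finite_induct) (auto intro: empty semialgebraic.union)
  show "semialgebraic (\<Union>i\<in>I. F i)" by (rule Un[OF assms(2)])
  have "(\<Inter>i\<in>I. F i) = - (\<Union>i\<in>I. - F i)" by auto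
  also have "semialgebraic \<dots>"
    by (intro semialgebraic.complement Un assms(2))
  finally show "semialgebraic (\<Inter>i\<in>I. F i)" .
qed

text \<open>The Gram matrix of the rows indexed by \<open>I\<close>, padded by an identity block on the other indices. The
  padding keeps the index type independent of \<open>I\<close>, without affecting the determinant.\<close>

definition row_gram :: "'m set \<Rightarrow> real^'n^'m \<Rightarrow> real^'m^'m" where
  "row_gram I A = (\<chi> i j. if i \<in> I \<and> j \<in> I then row i A \<bullet> row j A else if i = j then 1 else 0)"

text \<open>A vector \<open>c\<close> in the kernel of the padded Gram matrix vanishes outside \<open>I\<close>, and inside \<open>I\<close> the vector
  \<open>s = \<Sum>i\<in>I. c i *\<^sub>R row i A\<close> is orthogonal to each of the rows it combines, hence to itself, so \<open>s = 0\<close>. The right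
  side says that the rows are independent as a family, so that repeated rows count as dependent.\<close>

lemma det_row_gram_nonzero_iff:
  "det (row_gram I A) \<noteq> 0 \<longleftrightarrow>
    (\<forall>c. (\<Sum>i\<in>I. c i *\<^sub>R row i A) = 0 \<longrightarrow> (\<forall>i\<in>I. c i = 0))"
proof -
  have entry: "(row_gram I A *v x) $ i =
      (if i \<in> I then row i A \<bullet> (\<Sum>j\<in>I. x $ j *\<^sub>R row j A) else x $ i)" for x i
  proof (cases "i \<in> I")
    case True
    have "(row_gram I A *v x) $ i = (\<Sum>j\<in>UNIV. if j \<in> I then (row i A \<bullet> row j A) * x $ j else 0)"
      using True by (auto simp: row_gram_def matrix_vector_mult_def intro!: sum.cong)
    also have "\<dots> = (\<Sum>j\<in>I. (row i A \<bullet> row j A) * x $ j)"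
      by (simp add: sum.If_cases)
    finally show ?thesis using True by (simp add: inner_sum_right mult.commute)
  next
    case False
    have "(row_gram I A *v x) $ i = (\<Sum>j\<in>UNIV. if i = j then x $ j else 0)"
      unfolding row_gram_def matrix_vector_mult_def vec_lambda_beta
      by (rule sum.cong) (use False in auto)
    then show ?thesis using False by simp
  qed
  have "det (row_gram I A) \<noteq> 0 \<longleftrightarrow> (\<forall>x. row_gram I A *v x = 0 \<longrightarrow> x = 0)"
    by (simp add: invertible_det_nz[symmetric] invertible_left_inverse matrix_left_invertible_ker)
  also have "\<dots> \<longleftrightarrow> (\<forall>c. (\<Sum>i\<in>I. c i *\<^sub>R row i A) = 0 \<longrightarrow> (\<forall>i\<in>I. c i = 0))"
  proof safe
    fix c i
    assume inj: "\<forall>x. row_gram I A *v x = 0 \<longrightarrow> x = 0"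
      and c: "(\<Sum>i\<in>I. c i *\<^sub>R row i A) = 0" and i: "i \<in> I"
    let ?x = "\<chi> j. if j \<in> I then c j else 0"
    have sum: "(\<Sum>j\<in>I. ?x $ j *\<^sub>R row j A) = 0" using c by simp
    have "(row_gram I A *v ?x) $ k = 0" for k
      unfolding entry sum by simp
    then have "row_gram I A *v ?x = 0" by (simp add: vec_eq_iff)
    then have "?x $ i = 0" using inj by (metis zero_index)
    then show "c i = 0" using i by simp
  next
    fix x
    assume ind: "\<forall>c. (\<Sum>i\<in>I. c i *\<^sub>R row i A) = 0 \<longrightarrow> (\<forall>i\<in>I. c i = 0)"
      and x: "row_gram I A *v x = 0"
    let ?s = "\<Sum>j\<in>I. x $ j *\<^sub>R row j A"
    have "row i A \<bullet> ?s = 0" if "i \<in> I" for i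
      using entry[of x i] x that by simp
    then have "?s \<bullet> ?s = 0" by (simp add: inner_sum_left)
    then have "x $ i = 0" if "i \<in> I" for i
      using ind that by (auto dest: spec[of _ "\<lambda>i. x $ i"])
    moreover have "x $ i = 0" if "i \<notin> I" for i
      using entry[of x i] x that by simp
    ultimately show "x = 0" by (auto simp: vec_eq_iff)
  qed
  finally show ?thesis .
qed

lemma card_le_rank_if_det_row_gram_nonzero:
  fixes A :: "real^'n^'m"
  assumes "det (row_gram I A) \<noteq> 0"
  shows "card I \<le> rank A"
proof -
  note ind = assms[unfolded det_row_gram_nonzero_iff, rule_format]
  have inj: "inj_on (\<lambda>i. row i A) I"
  proof (rule inj_onI, rule ccontr)
    fix i j assume ij: "i \<in> I" "j \<in> I" "row i A = row j A" "i \<noteq> j"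
    let ?c = "\<lambda>k. if k = i then 1 else if k = j then -1 else (0::real)"
    have "(\<Sum>k\<in>I. ?c k *\<^sub>R row k A) = (\<Sum>k\<in>{i,j}. ?c k *\<^sub>R row k A)"
      by (rule sum.mono_neutral_right) (use ij in auto)
    then have "(\<Sum>k\<in>I. ?c k *\<^sub>R row k A) = 0" using ij by simp
    from ind[OF this \<open>i \<in> I\<close>] show False by simp
  qed
  have "independent ((\<lambda>i. row i A) ` I)"
  proof (rule independent_if_scalars_zero)
    fix f x
    assume s: "(\<Sum>x\<in>(\<lambda>i. row i A) ` I. f x *\<^sub>R x) = 0" and x: "x \<in> (\<lambda>i. row i A) ` I"
    have "(\<Sum>i\<in>I. f (row i A) *\<^sub>R row i A) = 0"
      using s by (simp add: sum.reindex[OF inj] o_def)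
    from ind[OF this] x show "f x = 0" by auto
  qed simp
  then have "card ((\<lambda>i. row i A) ` I) \<le> dim (rows A)"
    by (rule independent_card_le_dim[rotated]) (auto simp: rows_def)
  then show ?thesis by (simp add: card_image[OF inj] row_rank_def)
qed

lemma exists_det_row_gram_nonzero:
  fixes A :: "real^'n^'m"
  shows "\<exists>I. card I = rank A \<and> det (row_gram I A) \<noteq> 0"
proof -
  obtain B where B: "B \<subseteq> rows A" "independent B" "card B = dim (rows A)"
    by (metis basis_exists)
  then obtain I where I: "B = (\<lambda>i. row i A) ` I" "inj_on (\<lambda>i. row i A) I"
    using subset_image_inj[of B "\<lambda>i. row i A" UNIV] by (auto simp: rows_def full_SetCompr_eq)
  have "c i = 0" if c: "(\<Sum>i\<in>I. c i *\<^sub>R row i A) = 0" and i: "i \<in> I" for c i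
  proof -
    let ?f = "\<lambda>x. c (the_inv_into I (\<lambda>i. row i A) x)"
    have "(\<Sum>x\<in>B. ?f x *\<^sub>R x) = 0"
      using c by (simp add: I(1) sum.reindex[OF I(2)] the_inv_into_f_f[OF I(2)])
    then have "?f (row i A) = 0"
      using independentD[OF B(2) finiteI_independent[OF B(2)] order_refl, of ?f] i I(1) by blast
    then show "c i = 0" by (simp add: the_inv_into_f_f[OF I(2) i])
  qed
  then have "det (row_gram I A) \<noteq> 0" unfolding det_row_gram_nonzero_iff by blast
  moreover have "card I = rank A" using B(3) I by (simp add: card_image row_rank_def)
  ultimately show ?thesis by blast
qed

lemma polynomial_function_row_gram:
  "polynomial_function (row_gram I :: real^'n^'m \<Rightarrow> real^'m^'m)"
proof -
  have "real_polynomial_function (\<lambda>A::real^'n^'m. A $ i $ j)" for i j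
    using polynomial_function_id[where 'a = "real^'n^'m"]
    unfolding polynomial_function_matrix_iff by blast
  then have "real_polynomial_function (\<lambda>A::real^'n^'m. row i A \<bullet> row j A)" for i j
    unfolding row_def inner_vec_def
    by (auto intro!: real_polynomial_function_sum real_polynomial_function.intros(4))
  then show ?thesis
    unfolding polynomial_function_matrix_iff row_gram_def vec_lambda_beta
    by (intro allI, rename_tac i j, case_tac "i \<in> I"; case_tac "j \<in> I"; case_tac "i = j")
      (simp_all add: real_polynomial_function.intros(2))
qed

text \<open>The rank is the largest size of an independent family of rows, and independence of a family is
  the polynomial inequation \<open>det (row_gram I A) \<noteq> 0\<close>.\<close>

lemma semialgebraic_rank_stratum:
  "semialgebraic (rank_stratum r :: (real^'n^'m) set)"
proof -
  let ?Z = "\<lambda>I. {A::real^'n^'m. det (row_gram I A) = 0}"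
  have Z: "semialgebraic (?Z I)" for I
    by (intro semialgebraic.zero real_polynomial_function_det polynomial_function_row_gram)
  have "rank A = r \<longleftrightarrow> (\<exists>I. card I = r \<and> det (row_gram I A) \<noteq> 0) \<and>
      (\<forall>I. card I > r \<longrightarrow> det (row_gram I A) = 0)" for A :: "real^'n^'m"
    using card_le_rank_if_det_row_gram_nonzero[of _ A] exists_det_row_gram_nonzero[of A]
    by (metis le_antisym not_le)
  then have eq: "(rank_stratum r :: (real^'n^'m) set) =
      - ((- (\<Union>I\<in>{I. card I = r}. - ?Z I)) \<union> (- (\<Inter>I\<in>{I. card I > r}. ?Z I)))"
    unfolding rank_stratum_def by auto
  show ?thesis
    unfolding eq
    by (intro semialgebraic.union semialgebraic.complement semialgebraic_finite_INT_UN Z finite)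
qed

section \<open>Traces over frames\<close>

text \<open>Both sides are linear in \<open>x\<close> and agree on \<open>E\<close>. This covers orthonormal bases (\<open>d\<close> the identity) as well
  as the dual basis formed with an inverse Gram matrix.\<close>

lemma dual_basis_expansion:
  fixes E :: "'a::real_inner set"
  assumes "finite E" "\<And>e f. e \<in> E \<Longrightarrow> f \<in> E \<Longrightarrow> e \<bullet> d f = (if e = f then 1 else 0)"
    and "x \<in> span E"
  shows "x = (\<Sum>f\<in>E. (x \<bullet> d f) *\<^sub>R f)"
  using assms(3)
proof (induction rule: span_induct)
  case base
  have "linear (\<lambda>x. x - (\<Sum>f\<in>E. (x \<bullet> d f) *\<^sub>R f))"
    by (rule linearI)
      (simp_all add: inner_add_left scaleR_left_distrib sum.distrib scaleR_right_diff_distrib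
        scaleR_right.sum)
  from linear_subspace_kernel[OF this] show ?case by simp
next
  case (step e)
  have "(\<Sum>f\<in>E. (e \<bullet> d f) *\<^sub>R f) = (\<Sum>f\<in>E. if e = f then f else 0)"
    by (rule sum.cong) (auto simp: assms(2)[OF step])
  then show ?case using step assms(1) by simp
qed

text \<open>The trace of a bilinear map with respect to the inner product does not depend on the frame. With
  the dual frame \<open>d f = \<Sum>h\<in>E. G' h f *\<^sub>R h\<close>, the left side is \<open>\<Sum>f\<in>E. b (d f) f\<close>. Expanding each \<open>d f\<close> in
  the family \<open>u\<close> and then collecting the sum over \<open>f\<close> gives \<open>\<Sum>k\<in>K. b (u k) (u k)\<close>.\<close>

lemma sum_inverse_gram_eq_sum_orthonormal:
  fixes b :: "'a::euclidean_space \<Rightarrow> 'a \<Rightarrow> 'a"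
  assumes "frame_of T E" "inverse_gram E G'" "bilinear b"
    and u: "\<And>k. k \<in> K \<Longrightarrow> u k \<in> T"
    and expand: "\<And>x. x \<in> T \<Longrightarrow> x = (\<Sum>k\<in>K. (x \<bullet> u k) *\<^sub>R u k)"
  shows "(\<Sum>e\<in>E. \<Sum>f\<in>E. G' e f *\<^sub>R b e f) = (\<Sum>k\<in>K. b (u k) (u k))"
proof -
  define d where "d f = (\<Sum>h\<in>E. G' h f *\<^sub>R h)" for f
  have E: "E \<subseteq> T" "independent E" "span E = T" using assms(1) by (auto simp: frame_of_def)
  then have fin: "finite E" using independent_imp_finite by blast
  have linl: "linear (\<lambda>x. b x y)" and linr: "linear (b x)" for x y
    using assms(3) by (auto simp: bilinear_def)
  have dual: "e \<bullet> d f = (if e = f then 1 else 0)" if "e \<in> E" "f \<in> E" for e f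
    using assms(2) that unfolding inverse_gram_def d_def by (simp add: inner_sum_right mult.commute)
  have dT: "d f \<in> T" for f
    using E by (auto simp: d_def intro: span_sum span_scale span_base)
  have recon: "x = (\<Sum>f\<in>E. (x \<bullet> d f) *\<^sub>R f)" if "x \<in> T" for x
    using dual_basis_expansion[OF fin dual] that E(3) by blast
  have "(\<Sum>e\<in>E. \<Sum>f\<in>E. G' e f *\<^sub>R b e f) = (\<Sum>f\<in>E. \<Sum>e\<in>E. G' e f *\<^sub>R b e f)"
    by (rule sum.swap)
  also have "\<dots> = (\<Sum>f\<in>E. b (d f) f)"
    by (simp add: d_def linear_sum[OF linl] linear_cmul[OF linl])
  also have "\<dots> = (\<Sum>f\<in>E. \<Sum>k\<in>K. (d f \<bullet> u k) *\<^sub>R b (u k) f)"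
    by (subst expand[OF dT]) (simp add: linear_sum[OF linl] linear_cmul[OF linl])
  also have "\<dots> = (\<Sum>k\<in>K. \<Sum>f\<in>E. (u k \<bullet> d f) *\<^sub>R b (u k) f)"
    by (subst sum.swap) (simp add: inner_commute)
  also have "\<dots> = (\<Sum>k\<in>K. b (u k) (\<Sum>f\<in>E. (u k \<bullet> d f) *\<^sub>R f))"
    by (simp add: linear_sum[OF linr] linear_cmul[OF linr])
  also have "\<dots> = (\<Sum>k\<in>K. b (u k) (u k))"
    by (rule sum.cong) (use recon u in auto)
  finally show ?thesis .
qed

lemma orthonormal_expansion:
  fixes B :: "'a::euclidean_space set"
  assumes "pairwise orthogonal B" "\<And>b. b \<in> B \<Longrightarrow> norm b = 1" "finite B" "x \<in> span B"
  shows "x = (\<Sum>b\<in>B. (x \<bullet> b) *\<^sub>R b)"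
  by (rule dual_basis_expansion[OF assms(3) _ assms(4)])
    (use assms(1,2) in \<open>auto simp: pairwise_def orthogonal_def norm_eq_1\<close>)

text \<open>The symmetry argument behind minimality. If \<open>k\<close> runs through an orthonormal basis of \<open>T\<close>, then so does
  \<open>R k\<close>, because \<open>R\<close> is a self-adjoint involution. Both bases give the same trace of \<open>b\<close>, but \<open>R\<close> reverses the
  sign of \<open>b\<close>, so the trace is zero.\<close>

lemma mean_curvature_eq_0_if_reflection:
  fixes b :: "'a::euclidean_space \<Rightarrow> 'a \<Rightarrow> 'a"
  assumes T: "subspace T" "tangent_space X p = T"
    and b: "\<And>\<xi> \<eta>. \<xi> \<in> T \<Longrightarrow> \<eta> \<in> T \<Longrightarrow> second_fundamental_form X p \<xi> \<eta> = b \<xi> \<eta>" "bilinear b"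
    and R: "linear R" "\<And>x. x \<in> T \<Longrightarrow> R x \<in> T" "\<And>x. R (R x) = x" "\<And>x y. R x \<bullet> y = x \<bullet> R y"
    and anti: "\<And>x y. b (R x) (R y) = - b x y"
  shows "mean_curvature X p = 0"
proof -
  obtain B where B: "B \<subseteq> T" "pairwise orthogonal B" "\<And>x. x \<in> B \<Longrightarrow> norm x = 1"
    "independent B" "span B = T"
    using orthonormal_basis_subspace[OF T(1)] by metis
  have fin: "finite B" using B(4) independent_imp_finite by blast
  have expand: "x = (\<Sum>k\<in>B. (x \<bullet> k) *\<^sub>R k)" if "x \<in> T" for x
    using orthonormal_expansion[OF B(2,3) fin] that B(5) by blast
  have expandR: "x = (\<Sum>k\<in>B. (x \<bullet> R k) *\<^sub>R R k)" if "x \<in> T" for x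
  proof -
    have "R x = (\<Sum>k\<in>B. (x \<bullet> R k) *\<^sub>R k)"
      using expand[OF R(2)[OF that]] by (simp add: R(4))
    then have "R (R x) = (\<Sum>k\<in>B. (x \<bullet> R k) *\<^sub>R R k)"
      by (simp add: linear_sum[OF R(1)] linear_cmul[OF R(1)])
    then show ?thesis by (simp add: R(3))
  qed
  have zero: "(\<Sum>e\<in>E. \<Sum>f\<in>E. G' e f *\<^sub>R second_fundamental_form X p e f) = 0"
    if E: "frame_of T E" "inverse_gram E G'" for E G'
  proof -
    define s where "s = (\<Sum>e\<in>E. \<Sum>f\<in>E. G' e f *\<^sub>R b e f)"
    have "s = (\<Sum>k\<in>B. b k k)"
      unfolding s_def by (rule sum_inverse_gram_eq_sum_orthonormal[OF E b(2)]) (use B(1) expand in auto)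
    moreover have "s = (\<Sum>k\<in>B. b (R k) (R k))"
      unfolding s_def by (rule sum_inverse_gram_eq_sum_orthonormal[OF E b(2)]) (use B(1) R(2) expandR in auto)
    ultimately have "s = - s" by (simp add: anti sum_negf)
    then have "s = 0" by (simp add: eq_neg_iff_add_eq_0 flip: scaleR_2)
    moreover have "(\<Sum>e\<in>E. \<Sum>f\<in>E. G' e f *\<^sub>R second_fundamental_form X p e f) = s"
      unfolding s_def by (intro sum.cong refl) (use E(1) b(1) in \<open>auto simp: frame_of_def\<close>)
    ultimately show ?thesis by simp
  qed
  have frame: "frame_of T B" using B by (simp add: frame_of_def)
  have "(\<Sum>h\<in>B. (e \<bullet> h) * (if h = f then 1 else 0)) = (if e = f then 1 else 0)"
    if "e \<in> B" "f \<in> B" for e f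
  proof -
    have "(\<Sum>h\<in>B. (e \<bullet> h) * (if h = f then 1 else 0)) = e \<bullet> f"
      using fin that by (simp add: if_distrib cong: if_cong)
    then show ?thesis
      using B(2,3) that by (auto simp: pairwise_def orthogonal_def norm_eq_1)
  qed
  then have gram: "inverse_gram B (\<lambda>e f. if e = f then 1 else 0)"
    by (simp add: inverse_gram_def)
  show ?thesis
    unfolding mean_curvature_def T(2)
  proof (rule the_equality)
    show "\<exists>E G'. frame_of T E \<and> inverse_gram E G' \<and>
        0 = (\<Sum>e\<in>E. \<Sum>f\<in>E. G' e f *\<^sub>R second_fundamental_form X p e f)"
      by (intro exI conjI, rule frame, rule gram, rule zero[OF frame gram, symmetric])
  qed (use zero in auto)
qed

section \<open>Pseudoinverses\<close>

text \<open>For an orthonormal basis \<open>B\<close> of \<open>V\<close>, the orthogonal projection is the sum of the rank-one matrices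
  \<open>b b\<^sup>T\<close> over \<open>b \<in> B\<close>.\<close>

lemma exists_projection_matrix:
  fixes V :: "(real^'n) set"
  assumes "subspace V"
  shows "\<exists>P::real^'n^'n. transpose P = P \<and> (\<forall>x\<in>V. P *v x = x) \<and> (\<forall>x. P *v x \<in> V)"
proof -
  obtain B where B: "B \<subseteq> V" "pairwise orthogonal B" "\<And>x. x \<in> B \<Longrightarrow> norm x = 1"
    "independent B" "span B = V"
    using orthonormal_basis_subspace[OF assms] by metis
  have fin: "finite B" using B(4) independent_imp_finite by blast
  define P where "P = (\<chi> i j. \<Sum>b\<in>B. b $ i * b $ j)"
  have P: "P *v x = (\<Sum>b\<in>B. (x \<bullet> b) *\<^sub>R b)" for x
  proof -
    have "(P *v x) $ i = (\<Sum>j\<in>UNIV. \<Sum>b\<in>B. b $ i * b $ j * x $ j)" for i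
      by (simp add: P_def matrix_vector_mult_def sum_distrib_right)
    also have "\<dots> i = (\<Sum>b\<in>B. \<Sum>j\<in>UNIV. b $ i * b $ j * x $ j)" for i
      by (rule sum.swap)
    finally show ?thesis
      by (simp add: vec_eq_iff sum_component inner_vec_def sum_distrib_left sum_distrib_right mult_ac)
  qed
  have "transpose P = P" by (simp add: transpose_def P_def mult.commute)
  moreover have "P *v x = x" if "x \<in> V" for x
    using orthonormal_expansion[OF B(2,3) fin] that B(5) P by metis
  moreover have "P *v x \<in> V" for x
    unfolding P using B(5) by (auto intro: span_sum span_scale span_base)
  ultimately show ?thesis by blast
qed

text \<open>The four Penrose equations. They make \<open>A ** A'\<close> and \<open>A' ** A\<close> the orthogonal projections onto the column
  space and the row space of \<open>A\<close>.\<close>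

locale moore_penrose =
  fixes A :: "real^'n^'m" and A' :: "real^'m^'n"
  assumes AAA: "A ** A' ** A = A" and A'AA': "A' ** A ** A' = A'"
    and sym_AA': "transpose (A ** A') = A ** A'" and sym_A'A: "transpose (A' ** A) = A' ** A"

text \<open>The matrix \<open>A\<close> maps its row space isomorphically onto its column space. Its pseudoinverse projects
  orthogonally to the column space and then inverts this isomorphism.\<close>

lemma exists_moore_penrose:
  fixes A :: "real^'n^'m"
  shows "\<exists>A'. moore_penrose A A'"
proof -
  obtain P :: "real^'m^'m" where P: "transpose P = P" "\<And>x. x \<in> range ((*v) A) \<Longrightarrow> P *v x = x"
    "\<And>x. P *v x \<in> range ((*v) A)"
    using exists_projection_matrix[of "range ((*v) A)"]
    by (metis linear_subspace_image matrix_vector_mul_linear subspace_UNIV)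
  have rowsp: "subspace (range ((*v) (transpose A)))"
    by (metis linear_subspace_image matrix_vector_mul_linear subspace_UNIV)
  obtain Q :: "real^'n^'n" where Q: "transpose Q = Q"
    "\<And>x. x \<in> range ((*v) (transpose A)) \<Longrightarrow> Q *v x = x"
    "\<And>x. Q *v x \<in> range ((*v) (transpose A))"
    using exists_projection_matrix[OF rowsp] by metis
  have "Q ** transpose A = transpose A"
    using Q(2) by (simp add: matrix_eq matrix_vector_mul_assoc[symmetric])
  then have AQ: "A ** Q = A"
    by (metis Q(1) matrix_transpose_mul transpose_transpose)
  have "inj_on ((*v) A) (range ((*v) (transpose A)))"
  proof (rule inj_onI)
    fix x y assume xy: "x \<in> range ((*v) (transpose A))" "y \<in> range ((*v) (transpose A))"
      and eq: "A *v x = A *v y"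
    then obtain z where z: "x - y = transpose A *v z"
      by (metis (no_types, lifting) matrix_vector_mult_diff_distrib rangeE)
    have "(x - y) \<bullet> (x - y) = (A *v (x - y)) \<bullet> z"
      by (metis z dot_lmul_matrix inner_commute vector_transpose_matrix transpose_transpose)
    also have "\<dots> = 0" using eq by (simp add: matrix_vector_mult_diff_distrib)
    finally show "x = y" by simp
  qed
  then obtain g where g: "range g \<subseteq> range ((*v) (transpose A))" "linear g"
    "\<And>v. v \<in> range ((*v) (transpose A)) \<Longrightarrow> g (A *v v) = v"
    using linear_exists_left_inverse_on[OF matrix_vector_mul_linear rowsp, of A] by auto
  define A' where "A' = matrix g ** P"
  have A': "A' *v y = g (P *v y)" for y
    by (simp add: A'_def matrix_vector_mul_assoc[symmetric] matrix_works g(2))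
  have A'A: "A' ** A = Q"
  proof (unfold matrix_eq, rule allI)
    fix x
    have "(A' ** A) *v x = g (P *v (A *v x))" by (simp add: A' matrix_vector_mul_assoc[symmetric])
    also have "P *v (A *v x) = A *v (Q *v x)" using P(2)[OF rangeI, of x] AQ by (simp add: matrix_vector_mul_assoc)
    also have "g \<dots> = Q *v x" by (rule g(3)[OF Q(3)])
    finally show "(A' ** A) *v x = Q *v x" .
  qed
  have AA': "A ** A' = P"
  proof (unfold matrix_eq, rule allI)
    fix y
    obtain x where "P *v y = A *v x" using P(3) by blast
    then have "P *v y = A *v (Q *v x)" using AQ by (simp add: matrix_vector_mul_assoc)
    then have "A' *v y = Q *v x" by (simp add: A' g(3)[OF Q(3)])
    then have "A *v (A' *v y) = P *v y" using \<open>P *v y = A *v (Q *v x)\<close> by simp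
    then show "(A ** A') *v y = P *v y" by (simp add: matrix_vector_mul_assoc)
  qed
  have "Q ** A' = A'"
    using g(1) Q(2) by (simp add: matrix_eq matrix_vector_mul_assoc[symmetric] A' image_subset_iff)
  moreover have "P ** A = A"
    using P(2) by (simp add: matrix_eq matrix_vector_mul_assoc[symmetric])
  ultimately have "moore_penrose A A'"
    by unfold_locales (simp_all add: A'A AA' P(1) Q(1))
  then show ?thesis ..
qed

section \<open>The Frobenius inner product and ranks of products\<close>

lemma inner_matrix_mult_left:
  fixes C :: "real^'n^'m" and X :: "real^'p^'n"
  shows "(C ** X) \<bullet> Y = X \<bullet> (transpose C ** Y)"
  by (simp add: inner_matrix_eq_frobenius matrix_transpose_mul matrix_mul_assoc)

lemma inner_transpose:
  fixes X Y :: "real^'n^'m"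
  shows "transpose X \<bullet> transpose Y = X \<bullet> Y"
  unfolding inner_vec_def transpose_def by (simp, rule sum.swap)

lemma inner_matrix_mult_right:
  fixes X :: "real^'n^'m" and C :: "real^'p^'n"
  shows "(X ** C) \<bullet> Y = X \<bullet> (Y ** transpose C)"
proof -
  have "(X ** C) \<bullet> Y = (transpose C ** transpose X) \<bullet> transpose Y"
    by (metis inner_transpose matrix_transpose_mul)
  also have "\<dots> = transpose X \<bullet> transpose (Y ** transpose C)"
    by (simp add: inner_matrix_mult_left matrix_transpose_mul)
  finally show ?thesis by (simp add: inner_transpose)
qed

lemma transpose_zero: "transpose (0 :: real^'n^'m) = 0"
  by (simp add: transpose_def vec_eq_iff)

lemma rank_mult_invertible_left:
  fixes g :: "real^'m^'m" and X :: "real^'n^'m"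
  assumes "invertible g"
  shows "rank (g ** X) = rank X"
proof (rule antisym[OF rank_mul_le_right])
  obtain g' where "g' ** g = mat 1" using assms by (auto simp: invertible_def)
  then have "X = g' ** (g ** X)" by (simp add: matrix_mul_assoc)
  then show "rank X \<le> rank (g ** X)" by (metis rank_mul_le_right)
qed

lemma rank_mult_invertible_right:
  fixes h :: "real^'n^'n" and X :: "real^'n^'m"
  assumes "invertible h"
  shows "rank (X ** h) = rank X"
  by (metis assms matrix_transpose_mul rank_mult_invertible_left rank_transpose transpose_invertible)

lemma dim_range_transpose:
  fixes M :: "real^'n^'m"
  shows "dim (range ((*v) (transpose M))) = rank M"
  by (simp only: rank_dim_range[symmetric] rank_transpose)

text \<open>The row space of \<open>C ** Y\<close> lies in that of \<open>Y\<close>; when the ranks agree the two are equal, so every row of \<open>Y\<close>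
  is a combination of rows of \<open>C ** Y\<close>.\<close>

lemma mult_eq_0_cancel_if_rank_eq:
  fixes C :: "real^'m^'l" and Y :: "real^'n^'m" and Z :: "real^'p^'n"
  assumes "rank (C ** Y) = rank Y" "C ** Y ** Z = 0"
  shows "Y ** Z = 0"
proof -
  let ?R = "\<lambda>M::real^_^_. range ((*v) (transpose M))"
  have sub: "?R (C ** Y) \<subseteq> ?R Y"
    by (auto simp: matrix_transpose_mul matrix_vector_mul_assoc[symmetric])
  have "dim (?R Y) \<le> dim (?R (C ** Y))"
    using assms(1) by (simp only: dim_range_transpose)
  then have eq: "?R (C ** Y) = ?R Y"
    by (intro subspace_dim_equal sub linear_subspace_image[OF matrix_vector_mul_linear]
        subspace_UNIV)
  have "(transpose Z ** transpose Y) *v x = 0" for x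
  proof -
    obtain y where "transpose Y *v x = transpose (C ** Y) *v y" using eq by blast
    then have "(transpose Z ** transpose Y) *v x = transpose (C ** Y ** Z) *v y"
      by (metis matrix_transpose_mul matrix_vector_mul_assoc)
    then show ?thesis by (simp add: assms(2) transpose_def vec_eq_iff matrix_vector_mult_def)
  qed
  then have "transpose (Y ** Z) = 0" by (simp add: matrix_transpose_mul matrix_eq)
  then show ?thesis by (simp add: transpose_def vec_eq_iff)
qed

text \<open>The kernel of \<open>M\<close> is the orthogonal complement of the row space.\<close>

lemma dim_kernel_plus_rank:
  fixes M :: "real^'n^'m"
  shows "dim {x. M *v x = 0} + rank M = CARD('n)"
proof -
  have "{x \<in> UNIV. \<forall>y \<in> range ((*v) (transpose M)). orthogonal y x} = {x. M *v x = 0}"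
  proof safe
    fix x assume *: "\<forall>y \<in> range ((*v) (transpose M)). orthogonal y x"
    have "(M *v x) \<bullet> (M *v x) = (transpose M *v (M *v x)) \<bullet> x"
      by (metis dot_lmul_matrix inner_commute vector_transpose_matrix transpose_transpose)
    also have "\<dots> = 0" using * by (auto simp: orthogonal_def)
    finally show "M *v x = 0" by simp
  next
    fix x y assume "M *v x = 0"
    have "(transpose M *v y) \<bullet> x = y \<bullet> (M *v x)"
      by (metis dot_lmul_matrix inner_commute vector_transpose_matrix transpose_transpose)
    with \<open>M *v x = 0\<close> show "orthogonal (transpose M *v y) x" by (simp add: orthogonal_def)
  qed auto
  then show ?thesis
    using dim_subspace_orthogonal_to_vectors[of "range ((*v) (transpose M))" UNIV]
    by (simp only: linear_subspace_image[OF matrix_vector_mul_linear] subspace_UNIV subset_UNIV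
        dim_range_transpose dim_UNIV) simp
qed

lemma invertible_near_identity:
  fixes g :: "real \<Rightarrow> real^'n^'n"
  assumes "polynomial_function g" "g 0 = mat 1"
  shows "\<forall>\<^sub>F t in nhds 0. invertible (g t)"
proof -
  have "open {t. det (g t) \<noteq> 0}" by (rule open_det_nonzero[OF assms(1)])
  moreover have "0 \<in> {t. det (g t) \<noteq> 0}" by (simp add: assms(2))
  ultimately have "\<forall>\<^sub>F t in nhds 0. t \<in> {t. det (g t) \<noteq> 0}"
    by (rule eventually_nhds_in_open)
  then show ?thesis by (simp add: invertible_det_nz)
qed

section \<open>Linear vector fields tangent to rank strata\<close>

lemma polynomial_function_affine_path:
  "polynomial_function (\<lambda>t::real. C + t *\<^sub>R D)"
  by (intro polynomial_function_add polynomial_function_mult polynomial_function_const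
      polynomial_function_id)

lemma velocity_in_tangent_space:
  fixes \<gamma> :: "real \<Rightarrow> 'a::euclidean_space"
  assumes "polynomial_function \<gamma>" "\<gamma> 0 = x" "\<forall>\<^sub>F t in nhds 0. \<gamma> t \<in> X"
    and "(\<gamma> has_vector_derivative v) (at 0)"
  shows "v \<in> tangent_space X x"
proof -
  obtain e where e: "e > 0" "\<And>t. dist t 0 < e \<Longrightarrow> \<gamma> t \<in> X"
    using assms(3) by (auto simp: eventually_nhds_metric)
  then have "\<gamma> ` {-e<..<e} \<subseteq> X" by (auto simp: dist_real_def)
  moreover have "smooth_on {-e<..<e} \<gamma>" by (rule smooth_on_polynomial_function[OF _ assms(1)]) simp
  ultimately show ?thesis using assms(2,4) e(1) unfolding tangent_space_def by blast
qed

text \<open>The curve \<open>(1 + t C) x (1 + t D)\<close> has constant rank near \<open>t = 0\<close>, because its outer factors are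
  invertible there, and its velocity at \<open>t = 0\<close> is \<open>C x + x D\<close>.\<close>

lemma linear_field_in_tangent_space:
  fixes x :: "real^'n^'m"
  assumes "rank x = r"
  shows "C ** x + x ** D \<in> tangent_space (rank_stratum r) x"
proof (rule velocity_in_tangent_space[where \<gamma> = "\<lambda>t. (mat 1 + t *\<^sub>R C) ** x ** (mat 1 + t *\<^sub>R D)"])
  show "polynomial_function (\<lambda>t. (mat 1 + t *\<^sub>R C) ** x ** (mat 1 + t *\<^sub>R D))"
    by (intro polynomial_function_matrix_mult polynomial_function_affine_path polynomial_function_const)
  have "\<forall>\<^sub>F t in nhds 0. invertible (mat 1 + t *\<^sub>R C)" "\<forall>\<^sub>F t in nhds 0. invertible (mat 1 + t *\<^sub>R D)"
    by (rule invertible_near_identity[OF polynomial_function_affine_path]; simp)+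
  then show "\<forall>\<^sub>F t in nhds 0. (mat 1 + t *\<^sub>R C) ** x ** (mat 1 + t *\<^sub>R D) \<in> rank_stratum r"
    by eventually_elim
      (simp add: rank_stratum_def assms rank_mult_invertible_left rank_mult_invertible_right)
  have "((\<lambda>t. mat 1 + t *\<^sub>R E) has_vector_derivative E) (at 0)" for E :: "real^'k^'k"
    by (auto intro!: derivative_eq_intros)
  note d = this
  have "((\<lambda>t. (mat 1 + t *\<^sub>R C) ** x) has_vector_derivative C ** x) (at 0)"
    using bounded_bilinear.has_vector_derivative[OF bounded_bilinear_matrix_mult d[of C]
        has_vector_derivative_const[of x]]
    by (simp add: matrix_mult_linear)
  from bounded_bilinear.has_vector_derivative[OF bounded_bilinear_matrix_mult this d[of D]]
  show "((\<lambda>t. (mat 1 + t *\<^sub>R C) ** x ** (mat 1 + t *\<^sub>R D)) has_vector_derivative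
      C ** x + x ** D) (at 0)"
    by (simp add: matrix_mult_linear add.commute)
qed simp

section \<open>Block decomposition along column space and row space\<close>

context moore_penrose
begin

text \<open>\<open>P\<close> and \<open>Q\<close> project onto the column space and the row space of \<open>A\<close>; \<open>Pc\<close> and \<open>Qc\<close> project onto the
  orthogonal complements of these spaces.\<close>

definition P where "P = A ** A'"
definition Q where "Q = A' ** A"
definition Pc where "Pc = mat 1 - P"
definition Qc where "Qc = mat 1 - Q"

lemma mult_eqs:
  "A ** A' = P" "A' ** A = Q" "P ** A = A" "A ** Q = A" "A' ** P = A'" "Q ** A' = A'"
  "P ** P = P" "Q ** Q = Q" "Pc ** A = 0" "A ** Qc = 0" "A' ** Pc = 0" "Qc ** A' = 0"
  "Pc ** Pc = Pc" "Qc ** Qc = Qc" "Pc ** P = 0" "P ** Pc = 0" "Qc ** Q = 0" "Q ** Qc = 0"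
proof -
  show "A ** A' = P" "A' ** A = Q" by (simp_all add: P_def Q_def)
  show 1: "P ** A = A" "Q ** A' = A'" by (simp_all add: P_def Q_def AAA A'AA')
  show 2: "A ** Q = A" "A' ** P = A'" by (simp_all add: P_def Q_def AAA A'AA' matrix_mul_assoc)
  show 3: "P ** P = P" "Q ** Q = Q"
    using 1 by (metis P_def matrix_mul_assoc, metis Q_def AAA matrix_mul_assoc)
  show 4: "Pc ** A = 0" "A ** Qc = 0" "A' ** Pc = 0" "Qc ** A' = 0"
    "Pc ** P = 0" "P ** Pc = 0" "Qc ** Q = 0" "Q ** Qc = 0"
    by (simp_all add: Pc_def Qc_def matrix_mult_linear 1 2 3)
  show "Pc ** Pc = Pc" "Qc ** Qc = Qc"
    using 4 by (simp_all add: Pc_def Qc_def matrix_mult_linear 3)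
qed

text \<open>The products are also stated with an arbitrary continuation \<open>Z\<close>, so that they apply
  inside longer right-associated products.\<close>

lemmas cancel = mult_eqs mult_eqs[THEN arg_cong[where f = "\<lambda>M. M ** Z" for Z], folded matrix_mul_assoc]
  matrix_mult_linear matrix_mul_assoc[symmetric]

lemma sym: "transpose P = P" "transpose Q = Q" "transpose Pc = Pc" "transpose Qc = Qc"
proof -
  show "transpose P = P" "transpose Q = Q" by (simp_all add: P_def Q_def sym_AA' sym_A'A)
  then show "transpose Pc = Pc" "transpose Qc = Qc"
    by (simp_all add: Pc_def Qc_def transpose_def vec_eq_iff mat_def)
qed

lemma left_annihilator: "E ** A = 0 \<Longrightarrow> E ** Pc = E"
  by (simp add: Pc_def P_def matrix_mult_linear matrix_mul_assoc)

lemma right_annihilator: "A ** F = 0 \<Longrightarrow> Qc ** F = F"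
  by (simp add: Qc_def Q_def matrix_mult_linear flip: matrix_mul_assoc)

text \<open>In block form with respect to the decompositions given by \<open>P\<close> and \<open>Q\<close>, this is the lower right block.
  The stratum of \<open>A\<close> will turn out to have exactly these matrices as normal vectors.\<close>

definition normal_part :: "real^'n^'m \<Rightarrow> real^'n^'m" where
  "normal_part v = Pc ** v ** Qc"

definition tangent :: "(real^'n^'m) set" where
  "tangent = {v. normal_part v = 0}"

lemma linear_normal_part: "linear normal_part"
  unfolding normal_part_def by (rule linearI) (simp_all add: matrix_mult_linear)

lemma subspace_tangent: "subspace tangent"
  unfolding tangent_def by (rule linear_subspace_kernel[OF linear_normal_part])

lemma inner_normal_part: "normal_part v \<bullet> w = v \<bullet> normal_part w"
  unfolding normal_part_def
  by (subst inner_matrix_mult_right, subst inner_matrix_mult_left) (simp add: sym matrix_mul_assoc)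

lemma normal_part_idem: "normal_part (normal_part v) = normal_part v"
  by (simp add: normal_part_def cancel)

text \<open>With the lower right block absent, \<open>v\<close> is the sum of its lower left block and its upper
  blocks; the former factors through \<open>A\<close> on the right and the latter factor through \<open>A\<close> on the left.\<close>

lemma tangent_decomp: "v \<in> tangent \<Longrightarrow> v = (Pc ** v ** A') ** A + A ** (A' ** v)"
proof -
  assume "v \<in> tangent"
  then have "Pc ** v = Pc ** v ** Q"
    by (simp add: tangent_def normal_part_def Qc_def matrix_mult_linear)
  moreover have "v = Pc ** v + P ** v" by (simp add: Pc_def matrix_mult_linear)
  ultimately show ?thesis by (simp add: Q_def P_def matrix_mul_assoc)
qed

section \<open>The Schur complement chart\<close>

text \<open>In block form \<open>S X\<close> has the rows \<open>(A' X\<^sub>1\<^sub>1, A' X\<^sub>1\<^sub>2)\<close> and \<open>(0, 1)\<close>, where \<open>A'\<close> identifies the column space of \<open>A\<close> with its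
  row space. Hence \<open>X ** matrix_inv (S X)\<close> is \<open>X\<close> after a column elimination, and its lower right block is the
  Schur complement \<open>X\<^sub>2\<^sub>2 - X\<^sub>2\<^sub>1 X\<^sub>1\<^sub>1\<^sup>-\<^sup>1 X\<^sub>1\<^sub>2\<close>. The matrix \<open>S X\<close> is square and close to the identity near \<open>A\<close>, so that
  no inverse of a rectangular block is needed.\<close>

definition S :: "real^'n^'m \<Rightarrow> real^'n^'n" where
  "S X = mat 1 + A' ** (X - A)"

definition U :: "(real^'n^'m) set" where
  "U = {X. det (S X) \<noteq> 0}"

lemma polynomial_S: "polynomial_function S"
  unfolding S_def[abs_def]
  by (intro polynomial_function_add polynomial_function_matrix_mult polynomial_function_const
      polynomial_function_diff polynomial_function_id)

lemma open_U: "open U"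
  unfolding U_def by (rule open_det_nonzero[OF polynomial_S])

lemma smooth_inv_S: "smooth_on U (\<lambda>X. matrix_inv (S X))"
  unfolding U_def by (rule smooth_on_matrix_inv[OF polynomial_S])

lemma S_A: "S A = mat 1" by (simp add: S_def matrix_mult_linear)

lemma A_in_U: "A \<in> U" by (simp add: U_def S_A)

lemma Qc_inv_S:
  assumes "X \<in> U"
  shows "Qc ** matrix_inv (S X) = Qc"
proof -
  have "Qc ** S X = Qc" by (simp add: S_def cancel)
  then have "Qc ** matrix_inv (S X) = Qc ** (S X ** matrix_inv (S X))"
    by (simp add: matrix_mul_assoc)
  then show ?thesis using matrix_inv_mult(1)[of "S X"] assms by (simp add: U_def)
qed

lemma A'_mult_inv_S:
  assumes "X \<in> U"
  shows "A' ** X ** matrix_inv (S X) = Q"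
proof -
  have "A' ** X = S X - Qc" by (simp add: S_def Qc_def Q_def matrix_mult_linear)
  then have "A' ** X ** matrix_inv (S X) = mat 1 - Qc"
    using matrix_inv_mult(1)[of "S X"] Qc_inv_S[OF assms] assms
    by (simp add: matrix_mult_linear U_def)
  then show ?thesis by (simp add: Qc_def)
qed

text \<open>The eliminated matrix \<open>Y = X ** matrix_inv (S X)\<close> satisfies \<open>P ** Y = A\<close>, so its upper blocks are those of
  \<open>A\<close>. Its rank exceeds that of \<open>A\<close> unless the Schur complement vanishes.\<close>

lemma rank_eq_iff_normal_part:
  assumes "X \<in> U"
  shows "rank X = rank A \<longleftrightarrow> normal_part (X ** matrix_inv (S X)) = 0"
proof -
  let ?Y = "X ** matrix_inv (S X)"
  have det: "det (S X) \<noteq> 0" using assms by (simp add: U_def)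
  have "invertible (matrix_inv (S X))"
    using matrix_inv_mult[OF det] by (auto simp: invertible_def)
  then have rank: "rank ?Y = rank X" by (rule rank_mult_invertible_right)
  have A'Y: "A' ** ?Y = Q" using A'_mult_inv_S[OF assms] by (simp add: matrix_mul_assoc)
  then have PY: "P ** ?Y = A"
    by (metis P_def AAA Q_def matrix_mul_assoc)
  have np: "normal_part ?Y = ?Y ** Qc"
  proof -
    have "P ** ?Y ** Qc = 0" unfolding PY by (rule mult_eqs)
    then show ?thesis by (simp add: normal_part_def Pc_def matrix_mult_linear)
  qed
  show ?thesis
  proof
    assume "rank X = rank A"
    then have "rank (P ** ?Y) = rank ?Y" using PY rank by simp
    moreover have "P ** ?Y ** Qc = 0" unfolding PY by (rule mult_eqs)
    ultimately show "normal_part ?Y = 0" unfolding np by (rule mult_eq_0_cancel_if_rank_eq)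
  next
    assume "normal_part ?Y = 0"
    then have "?Y = ?Y ** Q" unfolding np by (simp add: Qc_def matrix_mult_linear)
    then have "rank ?Y \<le> rank A"
      by (metis Q_def matrix_mul_assoc rank_mul_le_right)
    moreover have "rank A \<le> rank ?Y" using PY by (metis rank_mul_le_right)
    ultimately show "rank X = rank A" using rank by simp
  qed
qed

text \<open>Adding this matrix to \<open>X\<close> replaces the lower right block of \<open>X\<close> by the Schur complement, that is,
  it subtracts \<open>X\<^sub>2\<^sub>1 X\<^sub>1\<^sub>1\<^sup>-\<^sup>1 X\<^sub>1\<^sub>2\<close>. As this product does not involve the lower right block itself, the result is a shear.\<close>

definition shear :: "real^'n^'m \<Rightarrow> real^'n^'m" where
  "shear X = Pc ** X ** Q ** matrix_inv (S X) ** Qc"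

lemma shear_add_normal: "shear (X + Pc ** Z ** Qc) = shear X" "S (X + Pc ** Z ** Qc) = S X"
proof -
  show S: "S (X + Pc ** Z ** Qc) = S X" by (simp add: S_def cancel)
  show "shear (X + Pc ** Z ** Qc) = shear X"
    unfolding shear_def S by (simp add: cancel)
qed

lemma smooth_shear: "smooth_on U shear"
  unfolding shear_def[abs_def]
  by (intro smooth_on_bilinear[OF open_U bounded_bilinear_matrix_mult] smooth_inv_S
      smooth_on_polynomial_function[OF open_U] polynomial_function_const polynomial_function_id)

lemma chart: "diffeomorphism_on U U (\<lambda>X. X + shear X)"
proof (rule diffeomorphism_on_shear[OF open_U smooth_shear])
  fix X assume X: "X \<in> U"
  have s: "shear X = Pc ** (X ** Q ** matrix_inv (S X)) ** Qc"
    by (simp add: shear_def matrix_mul_assoc)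
  have m: "X - shear X = X + Pc ** (- (X ** Q ** matrix_inv (S X))) ** Qc"
    by (simp add: s matrix_mult_linear)
  show "X + shear X \<in> U \<and> shear (X + shear X) = shear X"
    using X shear_add_normal[of X] unfolding U_def by (metis (no_types, lifting) mem_Collect_eq s)
  show "X - shear X \<in> U \<and> shear (X - shear X) = shear X"
    using X shear_add_normal[of X] unfolding U_def by (metis (no_types, lifting) mem_Collect_eq m)
qed

lemma normal_part_chart:
  assumes "X \<in> U"
  shows "normal_part (X + shear X) = normal_part (X ** matrix_inv (S X))"
proof -
  have "Pc ** X ** matrix_inv (S X) ** Qc =
      Pc ** X ** (Q + Qc) ** matrix_inv (S X) ** Qc"
    by (simp add: Qc_def)
  also have "\<dots> = shear X + Pc ** X ** (Qc ** matrix_inv (S X)) ** Qc"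
    by (simp add: shear_def matrix_mult_linear matrix_mul_assoc)
  also have "\<dots> = shear X + Pc ** X ** Qc"
    unfolding Qc_inv_S[OF assms] by (simp add: cancel)
  also have "\<dots> = normal_part (X + shear X)"
    by (simp add: normal_part_def shear_def cancel)
  finally show ?thesis by (simp add: normal_part_def matrix_mul_assoc)
qed

lemma chart_straightens:
  "(\<lambda>X. X + shear X) ` (U \<inter> rank_stratum (rank A)) = U \<inter> tangent"
proof -
  let ?\<phi> = "\<lambda>X. X + shear X"
  have image: "?\<phi> ` U = U" using chart by (simp add: diffeomorphism_on_def)
  have "X \<in> rank_stratum (rank A) \<longleftrightarrow> ?\<phi> X \<in> tangent" if "X \<in> U" for X
    using rank_eq_iff_normal_part[OF that] normal_part_chart[OF that]
    by (simp add: rank_stratum_def tangent_def)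
  then have "U \<inter> rank_stratum (rank A) = U \<inter> ?\<phi> -` tangent" by auto
  then have "?\<phi> ` (U \<inter> rank_stratum (rank A)) = ?\<phi> ` U \<inter> tangent" by auto
  then show ?thesis unfolding image .
qed

section \<open>Tangent and normal spaces of a rank stratum\<close>

text \<open>A tangent matrix \<open>v = B A + A C\<close> is the velocity of a curve of the form \<open>(1 + t B) A (1 + t C)\<close>. Conversely,
  along any curve \<open>\<gamma>\<close> in the stratum with \<open>\<gamma> 0 = A\<close> the matrix \<open>Pc ** \<gamma> t ** matrix_inv (S (\<gamma> t)) ** Qc\<close> vanishes. Since
  \<open>Pc ** A = 0\<close>, dividing by \<open>t\<close> and letting \<open>t\<close> tend to zero leaves \<open>Pc ** v ** Qc = 0\<close>.\<close>

lemma tangent_space_eq: "tangent_space (rank_stratum (rank A)) A = tangent"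
proof
  show "tangent \<subseteq> tangent_space (rank_stratum (rank A)) A"
    using tangent_decomp linear_field_in_tangent_space[OF refl] by (metis subsetI)
  show "tangent_space (rank_stratum (rank A)) A \<subseteq> tangent"
  proof
    fix v assume "v \<in> tangent_space (rank_stratum (rank A)) A"
    then obtain e \<gamma> where e: "e > 0" "\<gamma> ` {-e<..<e} \<subseteq> rank_stratum (rank A)"
      and \<gamma>: "\<gamma> 0 = A" "(\<gamma> has_vector_derivative v) (at 0)"
      unfolding tangent_space_def by auto
    have cont: "(\<gamma> \<longlongrightarrow> A) (at 0)"
      using has_vector_derivative_continuous[OF \<gamma>(2)] \<gamma>(1) by (simp add: isCont_def)
    have "((\<lambda>t. (\<gamma> t - A - t *\<^sub>R v) /\<^sub>R \<bar>t\<bar>) \<longlongrightarrow> 0) (at 0)"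
      using \<gamma> by (simp add: has_vector_derivative_def has_derivative_at_within)
    then have "((\<lambda>t. norm ((\<gamma> t - A - t *\<^sub>R v) /\<^sub>R \<bar>t\<bar>)) \<longlongrightarrow> 0) (at 0)"
      by (rule tendsto_norm_zero)
    moreover have "\<forall>\<^sub>F t in at 0. norm ((\<gamma> t - A - t *\<^sub>R v) /\<^sub>R \<bar>t\<bar>) =
        norm ((\<gamma> t - A) /\<^sub>R t - v)"
      unfolding eventually_at_filter
    proof (intro always_eventually allI impI)
      fix t :: real assume "t \<noteq> 0"
      then have "(\<gamma> t - A) /\<^sub>R t - v = (\<gamma> t - A - t *\<^sub>R v) /\<^sub>R t"
        by (simp add: scaleR_diff_right)
      then show "norm ((\<gamma> t - A - t *\<^sub>R v) /\<^sub>R \<bar>t\<bar>) = norm ((\<gamma> t - A) /\<^sub>R t - v)"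
        by simp
    qed
    ultimately have "((\<lambda>t. norm ((\<gamma> t - A) /\<^sub>R t - v)) \<longlongrightarrow> 0) (at 0)"
      by (rule Lim_transform_eventually)
    then have quot: "((\<lambda>t. (\<gamma> t - A) /\<^sub>R t) \<longlongrightarrow> v) (at 0)"
      by (rule LIM_zero_cancel[OF tendsto_norm_zero_cancel])
    have "((\<lambda>t. matrix_inv (S (\<gamma> t))) \<longlongrightarrow> matrix_inv (S A)) (at 0)"
    proof -
      have "isCont (\<lambda>X. matrix_inv (S X)) A"
        using smooth_on_imp_continuous_on[OF smooth_inv_S] open_U A_in_U
        by (simp add: continuous_on_eq_continuous_at)
      then show ?thesis by (rule isCont_tendsto_compose[OF _ cont])
    qed
    then have inv: "((\<lambda>t. matrix_inv (S (\<gamma> t))) \<longlongrightarrow> mat 1) (at 0)"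
      using matrix_inv_mult(1)[of "S A"] by (simp add: S_A)
    let ?h = "\<lambda>t. Pc ** ((\<gamma> t - A) /\<^sub>R t) ** matrix_inv (S (\<gamma> t)) ** Qc"
    have lim: "(?h \<longlongrightarrow> Pc ** v ** mat 1 ** Qc) (at 0)"
      by (intro bounded_bilinear.tendsto[OF bounded_bilinear_matrix_mult] tendsto_const quot inv)
    have "\<forall>\<^sub>F t in at 0. ?h t = 0"
    proof -
      have "\<forall>\<^sub>F t in at 0. \<gamma> t \<in> U"
        by (rule topological_tendstoD[OF cont open_U A_in_U])
      moreover have "\<forall>\<^sub>F t in at 0. t \<in> {-e<..<e}"
        by (rule eventually_at_in_open') (use e in auto)
      ultimately show ?thesis
      proof eventually_elim
        case (elim t)
        have "\<gamma> t \<in> rank_stratum (rank A)"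
          using e(2) elim(2) by (rule subsetD[OF _ imageI])
        then have "rank (\<gamma> t) = rank A" by (simp add: rank_stratum_def)
        then have "normal_part (\<gamma> t ** matrix_inv (S (\<gamma> t))) = 0"
          using rank_eq_iff_normal_part[OF elim(1)] by simp
        then show ?case by (simp add: normal_part_def matrix_mult_linear mult_eqs matrix_mul_assoc)
      qed
    qed
    then have "(?h \<longlongrightarrow> 0) (at 0)" by (rule tendsto_eventually)
    then have "Pc ** v ** mat 1 ** Qc = 0" by (rule tendsto_unique[OF trivial_limit_at lim])
    then show "v \<in> tangent" by (simp add: tangent_def normal_part_def)
  qed
qed

lemma normal_component_eq: "normal_component tangent v = normal_part v"
  unfolding normal_component_def
proof (rule the_equality)
  show "normal_part v \<in> tangent\<^sup>\<bottom> \<and> v - normal_part v \<in> tangent"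
    by (auto simp: orthogonal_comp_def orthogonal_def tangent_def inner_normal_part[symmetric]
        linear_diff[OF linear_normal_part] normal_part_idem inner_commute)
next
  fix w assume w: "w \<in> tangent\<^sup>\<bottom> \<and> v - w \<in> tangent"
  let ?d = "w - normal_part v"
  have "?d \<in> tangent"
    using w by (simp add: tangent_def linear_diff[OF linear_normal_part] normal_part_idem)
  then have "?d \<bullet> w = 0" "?d \<bullet> normal_part v = 0"
    using w by (auto simp: orthogonal_comp_def orthogonal_def tangent_def inner_normal_part[symmetric])
  then have "?d \<bullet> ?d = 0" by (simp add: inner_diff_right)
  then show "w = normal_part v" by simp
qed

end

text \<open>Tangency at an arbitrary point \<open>x\<close>, without mention of a pseudoinverse of \<open>x\<close>. Along a curve of points this form
  is easy to differentiate, as annihilators that depend on the parameter polynomially can be chosen.\<close>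

lemma tangent_space_annihilated:
  fixes x :: "real^'n^'m"
  assumes "v \<in> tangent_space (rank_stratum (rank x)) x" "E ** x = 0" "x ** F = 0"
  shows "E ** v ** F = 0"
proof -
  obtain x' where "moore_penrose x x'" using exists_moore_penrose by blast
  then interpret moore_penrose x x' .
  have "Pc ** v ** Qc = 0"
    using assms(1) unfolding tangent_space_eq by (simp add: tangent_def normal_part_def)
  then have "E ** Pc ** v ** (Qc ** F) = 0"
    by (metis matrix_mul_assoc matrix_mult_linear(9,10))
  then show ?thesis using left_annihilator[OF assms(2)] right_annihilator[OF assms(3)] by simp
qed

section \<open>The second fundamental form of a rank stratum\<close>

context moore_penrose
begin

text \<open>The closed form of the second fundamental form of the stratum at \<open>A\<close>.\<close>

definition bend :: "real^'n^'m \<Rightarrow> real^'n^'m \<Rightarrow> real^'n^'m" where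
  "bend \<xi> \<eta> = normal_part (\<xi> ** A' ** \<eta> + \<eta> ** A' ** \<xi>)"

lemma bilinear_bend: "bilinear bend"
  unfolding bilinear_def bend_def normal_part_def
  by (auto intro!: linearI simp: matrix_mult_linear scaleR_right_distrib)

lemma exists_tangent_extension:
  assumes "\<eta> \<in> tangent"
  shows "\<exists>Y. tangent_extension (rank_stratum (rank A)) A \<eta> Y"
proof -
  let ?Y = "\<lambda>x. (Pc ** \<eta> ** A') ** x + x ** (A' ** \<eta>)"
  have "smooth_on UNIV ?Y"
    by (intro smooth_on_polynomial_function open_UNIV polynomial_function_add
        polynomial_function_matrix_mult polynomial_function_const polynomial_function_id)
  moreover have "?Y x \<in> tangent_space (rank_stratum (rank A)) x" if "x \<in> rank_stratum (rank A)" for x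
    by (rule linear_field_in_tangent_space) (use that in \<open>simp add: rank_stratum_def\<close>)
  moreover have "?Y A = \<eta>" by (rule tangent_decomp[OF assms, symmetric])
  ultimately have "tangent_extension (rank_stratum (rank A)) A \<eta> ?Y"
    unfolding tangent_extension_def by (intro conjI exI[of _ UNIV]) auto
  show ?thesis by (rule exI[of _ ?Y]) fact
qed

text \<open>Along a curve \<open>\<gamma>\<close> in the stratum with velocity \<open>\<xi>\<close>, pick matrices \<open>E t\<close> and \<open>F t\<close> with \<open>E t ** \<gamma> t = 0\<close> and
  \<open>\<gamma> t ** F t = 0\<close>. Tangency of \<open>Y\<close> gives \<open>E t ** Y (\<gamma> t) ** F t = 0\<close>, and the derivative of this equation at
  \<open>t = 0\<close> expresses the normal part of the derivative of \<open>Y\<close> through \<open>\<xi>\<close> and \<open>\<eta>\<close>.\<close>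

lemma normal_part_derivative:
  assumes Y: "tangent_extension (rank_stratum (rank A)) A \<eta> Y" and \<xi>: "\<xi> \<in> tangent"
  shows "normal_part (euclidean_connection \<xi> Y A) = bend \<xi> \<eta>"
proof -
  obtain W where W: "open W" "A \<in> W" "smooth_on W Y"
    and tan: "\<And>x. x \<in> W \<inter> rank_stratum (rank A) \<Longrightarrow> Y x \<in> tangent_space (rank_stratum (rank A)) x"
    and YA: "Y A = \<eta>"
    using Y unfolding tangent_extension_def by blast
  \<comment> \<open>The lower left, upper right and upper left blocks of \<open>\<xi>\<close> are \<open>B ** A\<close>, \<open>A ** C\<close> and \<open>D ** A\<close>. The matrices \<open>B\<close>
      and \<open>C\<close> square to zero, so \<open>1 + t B\<close> and \<open>1 + t C\<close> have the inverses \<open>1 - t B\<close> and \<open>1 - t C\<close>, which makes \<open>E\<close> and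
      \<open>F\<close> affine in \<open>t\<close>. The factor \<open>1 + t D\<close> preserves the column space of \<open>A\<close>.\<close>
  define B where "B = Pc ** \<xi> ** A'"
  define C where "C = A' ** \<xi> ** Qc"
  define D where "D = P ** \<xi> ** A'"
  define \<gamma> where "\<gamma> t = (mat 1 + t *\<^sub>R B) ** (mat 1 + t *\<^sub>R D) ** A ** (mat 1 + t *\<^sub>R C)" for t
  define E where "E t = Pc - t *\<^sub>R B" for t
  define F where "F t = Qc - t *\<^sub>R C" for t
  have E\<gamma>: "E t ** \<gamma> t = 0" and \<gamma>F: "\<gamma> t ** F t = 0" for t
    by (simp_all add: E_def F_def \<gamma>_def B_def C_def D_def cancel scaleR_right_distrib
        scaleR_right_diff_distrib)
  have affine: "((\<lambda>t. M + t *\<^sub>R N) has_vector_derivative N) (at 0)" for M N :: "real^'k^'l"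
    by (auto intro!: derivative_eq_intros)
  note prod = bounded_bilinear.has_vector_derivative[OF bounded_bilinear_matrix_mult]
  have "(\<gamma> has_vector_derivative (B ** A + D ** A + A ** C)) (at 0)"
    using prod[OF prod[OF prod[OF affine[of "mat 1" B] affine[of "mat 1" D]]
          has_vector_derivative_const[of A]] affine[of "mat 1" C]]
    unfolding \<gamma>_def[abs_def] by (simp add: matrix_mult_linear add_ac)
  moreover have "B ** A + D ** A + A ** C = \<xi>"
  proof -
    have "B ** A + D ** A + A ** C = (Pc + P) ** \<xi> ** Q + P ** \<xi> ** Qc"
      by (simp add: B_def C_def D_def P_def Q_def matrix_mult_linear matrix_mul_assoc)
    also have "\<dots> = (Pc + P) ** \<xi> ** (Q + Qc)"
      using \<xi> by (simp add: tangent_def normal_part_def matrix_mult_linear)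
    also have "\<dots> = \<xi>" by (simp add: Pc_def Qc_def)
    finally show ?thesis .
  qed
  ultimately have \<gamma>': "(\<gamma> has_vector_derivative \<xi>) (at 0)" by simp
  have \<gamma>0: "\<gamma> 0 = A" by (simp add: \<gamma>_def)
  let ?DY = "frechet_derivative Y (at A)"
  have DY: "(Y has_derivative ?DY) (at (\<gamma> 0))"
    using smooth_on_imp_has_derivative[OF W(1,3,2)] by (simp add: \<gamma>0)
  then have "linear ?DY" using has_derivative_linear by blast
  have Y\<gamma>: "((\<lambda>t. Y (\<gamma> t)) has_vector_derivative ?DY \<xi>) (at 0)"
    using diff_chain_at[OF \<gamma>'[unfolded has_vector_derivative_def] DY]
    by (simp add: has_vector_derivative_def o_def linear_cmul[OF \<open>linear ?DY\<close>])
  have E': "(E has_vector_derivative - B) (at 0)" and F': "(F has_vector_derivative - C) (at 0)"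
    using affine[of Pc "- B"] affine[of Qc "- C"] by (simp_all add: E_def[abs_def] F_def[abs_def])
  have "((\<lambda>t. E t ** Y (\<gamma> t) ** F t) has_vector_derivative
      (Pc ** \<eta> ** (- C) + (Pc ** ?DY \<xi> + (- B) ** \<eta>) ** Qc)) (at 0)"
    using prod[OF prod[OF E' Y\<gamma>] F'] by (simp add: \<gamma>0 YA E_def F_def)
  note lhs = this
  have "\<forall>\<^sub>F t in nhds 0. E t ** Y (\<gamma> t) ** F t = 0"
  proof -
    have "isCont \<gamma> 0" using has_vector_derivative_continuous[OF \<gamma>'] .
    then have "\<forall>\<^sub>F t in nhds 0. \<gamma> t \<in> W"
      using W(1,2) \<gamma>0 by (simp add: eventually_at_topological isCont_def
          tendsto_def eventually_nhds_conv_at)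
    moreover have "\<forall>\<^sub>F t in nhds 0. invertible (mat 1 + t *\<^sub>R B)"
      "\<forall>\<^sub>F t in nhds 0. invertible (mat 1 + t *\<^sub>R D)"
      "\<forall>\<^sub>F t in nhds 0. invertible (mat 1 + t *\<^sub>R C)"
      by (rule invertible_near_identity[OF polynomial_function_affine_path]; simp)+
    ultimately show ?thesis
    proof eventually_elim
      case (elim t)
      then have rank: "rank (\<gamma> t) = rank A"
        by (simp add: \<gamma>_def rank_mult_invertible_left rank_mult_invertible_right
            flip: matrix_mul_assoc)
      then have "Y (\<gamma> t) \<in> tangent_space (rank_stratum (rank (\<gamma> t))) (\<gamma> t)"
        using tan[of "\<gamma> t"] elim(1) by (simp add: rank_stratum_def)
      then show ?case using E\<gamma> \<gamma>F by (rule tangent_space_annihilated)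
    qed
  qed
  then obtain T where T: "open T" "0 \<in> T" "\<And>t. t \<in> T \<Longrightarrow> E t ** Y (\<gamma> t) ** F t = 0"
    unfolding eventually_nhds by blast
  have "((\<lambda>t. 0) has_vector_derivative
      (Pc ** \<eta> ** (- C) + (Pc ** ?DY \<xi> + (- B) ** \<eta>) ** Qc)) (at 0)"
    by (rule has_vector_derivative_transform_within_open[OF lhs T])
  then have "Pc ** \<eta> ** (- C) + (Pc ** ?DY \<xi> + (- B) ** \<eta>) ** Qc = 0"
    using vector_derivative_unique_at[OF _ has_vector_derivative_const] by blast
  then show ?thesis
    by (simp add: euclidean_connection_def bend_def normal_part_def B_def C_def cancel algebra_simps)
qed

lemma second_fundamental_form_eq:
  assumes "\<xi> \<in> tangent" "\<eta> \<in> tangent"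
  shows "second_fundamental_form (rank_stratum (rank A)) A \<xi> \<eta> = bend \<xi> \<eta>"
  unfolding second_fundamental_form_def tangent_space_eq normal_component_eq
proof (rule the_equality)
  obtain Y where "tangent_extension (rank_stratum (rank A)) A \<eta> Y"
    using exists_tangent_extension[OF assms(2)] by blast
  then show "\<exists>Y. tangent_extension (rank_stratum (rank A)) A \<eta> Y \<and>
      bend \<xi> \<eta> = normal_part (euclidean_connection \<xi> Y A)"
    using normal_part_derivative[OF _ assms(1)] by metis
next
  fix w
  assume "\<exists>Y. tangent_extension (rank_stratum (rank A)) A \<eta> Y \<and>
      w = normal_part (euclidean_connection \<xi> Y A)"
  then show "w = bend \<xi> \<eta>" using normal_part_derivative[OF _ assms(1)] by blast
qed

text \<open>The orthogonal reflection of all columns in the column space of \<open>A\<close>. It fixes \<open>A\<close>, preserves rank, and acts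
  as \<open>-1\<close> on the normal space at \<open>A\<close>, so it reverses the second fundamental form.\<close>

definition reflect :: "real^'n^'m \<Rightarrow> real^'n^'m" where
  "reflect X = (P - Pc) ** X"

lemma mean_curvature_eq_0: "mean_curvature (rank_stratum (rank A)) A = 0"
proof (rule mean_curvature_eq_0_if_reflection[OF subspace_tangent tangent_space_eq
      second_fundamental_form_eq bilinear_bend, where R = reflect])
  show "linear reflect"
    unfolding reflect_def by (rule linearI) (simp_all add: matrix_mult_linear)
  show "reflect x \<in> tangent" if "x \<in> tangent" for x
    using that by (simp add: tangent_def normal_part_def reflect_def cancel)
  show "reflect (reflect x) = x" for x
  proof -
    have "reflect (reflect x) = (P + Pc) ** x" by (simp add: reflect_def cancel)
    then show ?thesis by (simp add: Pc_def)
  qed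
  show "reflect x \<bullet> y = x \<bullet> reflect y" for x y
  proof -
    have "transpose (P - Pc) = P - Pc"
      using sym by (simp add: transpose_def vec_eq_iff)
    then show ?thesis by (simp add: reflect_def inner_matrix_mult_left)
  qed
  show "bend (reflect x) (reflect y) = - bend x y" for x y
    by (simp add: bend_def reflect_def normal_part_def cancel)
qed

section \<open>The dimension of a rank stratum\<close>

text \<open>This describes the normal space without pseudoinverses, in terms of the two kernels only.\<close>

lemma range_normal_part: "range normal_part = {N. transpose A ** N = 0 \<and> A ** transpose N = 0}"
proof safe
  fix v
  have "transpose A ** Pc = 0" "A ** Qc = 0"
    using mult_eqs(9,10) by (metis matrix_transpose_mul sym(3) transpose_zero, simp)
  then show "transpose A ** normal_part v = 0" "A ** transpose (normal_part v) = 0"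
    by (simp_all add: normal_part_def matrix_transpose_mul sym matrix_mul_assoc matrix_mult_linear)
next
  fix N assume N: "transpose A ** N = 0" "A ** transpose N = 0"
  have "P ** N = transpose A' ** (transpose A ** N)"
    by (metis P_def matrix_mul_assoc matrix_transpose_mul sym(1))
  then have "P ** N = 0" by (simp add: N matrix_mult_linear)
  moreover have "N ** Q = transpose (A' ** (A ** transpose N))"
    by (metis Q_def matrix_mul_assoc matrix_transpose_mul sym(2) transpose_transpose)
  then have "N ** Q = 0" by (simp add: N matrix_mult_linear transpose_zero)
  ultimately have "normal_part N = N" by (simp add: normal_part_def Pc_def Qc_def matrix_mult_linear)
  then show "N \<in> range normal_part" by (metis rangeI)
qed

lemma dim_tangent_plus_dim_normal: "dim tangent + dim (range normal_part) = DIM(real^'n^'m)"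
proof -
  have "{y \<in> UNIV. \<forall>x \<in> range normal_part. orthogonal x y} = tangent"
  proof safe
    fix y assume "\<forall>x \<in> range normal_part. orthogonal x y"
    then have "normal_part (normal_part y) \<bullet> y = 0" by (auto simp: orthogonal_def)
    then have "normal_part y \<bullet> normal_part y = 0" by (simp add: inner_normal_part)
    then show "y \<in> tangent" by (simp add: tangent_def)
  next
    fix y v assume "y \<in> tangent"
    then show "orthogonal (normal_part v) y"
      by (simp add: orthogonal_def inner_normal_part tangent_def)
  qed auto
  then show ?thesis
    using dim_subspace_orthogonal_to_vectors[of "range normal_part" UNIV]
    by (simp add: linear_subspace_image[OF linear_normal_part])
qed

end

text \<open>Kernels of matrices of equal rank have equal dimension, so some matrix \<open>F\<close> maps one into the other
  injectively. Injectivity is stated for matrices \<open>N\<close> whose columns lie in the kernel.\<close>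

lemma exists_kernel_embedding:
  fixes M M' :: "real^'n^'m"
  assumes "rank M = rank M'"
  obtains F :: "real^'n^'n" where "\<And>N::real^'k^'n. M ** N = 0 \<Longrightarrow> M' ** (F ** N) = 0"
    and "\<And>N::real^'k^'n. M ** N = 0 \<Longrightarrow> F ** N = 0 \<Longrightarrow> N = 0"
proof -
  have sub: "subspace {x. X *v x = 0}" for X :: "real^'n^'m"
    by (rule linear_subspace_kernel[OF matrix_vector_mul_linear])
  have "dim {x. M *v x = 0} \<le> dim {x. M' *v x = 0}"
    using assms dim_kernel_plus_rank[of M] dim_kernel_plus_rank[of M'] by simp
  from isometry_subset_subspace[OF sub sub this] obtain f where f: "linear f"
    "f \<in> {x. M *v x = 0} \<rightarrow> {x. M' *v x = 0}"
    "\<And>x. x \<in> {x. M *v x = 0} \<Longrightarrow> norm (f x) = norm x"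
    by metis
  have fN: "(matrix f ** N) *v x = f (N *v x)" for N :: "real^'k^'n" and x
    by (simp add: matrix_vector_mul_assoc[symmetric] matrix_works f(1))
  have ker: "N *v x \<in> {x. M *v x = 0}" if "M ** N = 0" for N :: "real^'k^'n" and x
    using that by (simp add: matrix_vector_mul_assoc)
  show ?thesis
  proof (rule that[of "matrix f"])
    fix N :: "real^'k^'n"
    assume N: "M ** N = 0"
    have "M' *v f (N *v x) = 0" for x
      using funcset_mem[OF f(2) ker[OF N]] by simp
    then show "M' ** (matrix f ** N) = 0"
      by (simp add: matrix_eq matrix_vector_mul_assoc[symmetric] matrix_works f(1))
    assume "matrix f ** N = 0"
    then have "N *v x = 0" for x
      using f(3)[OF ker[OF N]] fN by (metis matrix_vector_mult_0 norm_eq_zero)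
    then show "N = 0" by (simp add: matrix_eq)
  qed
qed

text \<open>Elements of these spaces map into the kernel of \<open>transpose A\<close> and have their rows in the kernel of \<open>A\<close>. Multiplication by
  kernel embeddings on both sides therefore sends the space for \<open>A\<close> injectively into the space for \<open>B\<close>.\<close>

lemma dim_biannihilator_mono:
  fixes A B :: "real^'n^'m"
  assumes "rank A = rank B"
  shows "dim {N. transpose A ** N = 0 \<and> A ** transpose N = 0} \<le>
    dim {N. transpose B ** N = 0 \<and> B ** transpose N = 0}"
proof -
  let ?N = "\<lambda>A::real^'n^'m. {N. transpose A ** N = 0 \<and> A ** transpose N = 0}"
  have transpose: "rank (transpose A) = rank (transpose B)"
    using assms by (simp only: rank_transpose)
  obtain F :: "real^'m^'m" where left:
    "\<And>N::real^'n^'m. transpose A ** N = 0 \<Longrightarrow> transpose B ** (F ** N) = 0"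
    "\<And>N::real^'n^'m. transpose A ** N = 0 \<Longrightarrow> F ** N = 0 \<Longrightarrow> N = 0"
    using exists_kernel_embedding[OF transpose] by metis
  obtain G :: "real^'n^'n" where right:
    "\<And>N::real^'m^'n. A ** N = 0 \<Longrightarrow> B ** (G ** N) = 0"
    "\<And>N::real^'m^'n. A ** N = 0 \<Longrightarrow> G ** N = 0 \<Longrightarrow> N = 0"
    using exists_kernel_embedding[OF assms] by metis
  define h where "h N = F ** N ** transpose G" for N
  have lin: "linear h" unfolding h_def[abs_def] by (rule linearI) (simp_all add: matrix_mult_linear)
  have "h N \<in> ?N B" if "N \<in> ?N A" for N
  proof -
    have "A ** (transpose N ** transpose F) = 0" "transpose A ** (N ** transpose G) = 0"
      using that by (simp_all add: matrix_mul_assoc matrix_mult_linear)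
    from right(1)[OF this(1)] left(1)[OF this(2)] show ?thesis
      by (simp add: h_def matrix_transpose_mul matrix_mul_assoc)
  qed
  then have image: "h ` ?N A \<subseteq> ?N B" by blast
  have N_sub: "subspace (?N A)"
  proof -
    have "transpose (x + y) = transpose x + transpose y" "transpose (c *\<^sub>R x) = c *\<^sub>R transpose x"
      for x y :: "real^'n^'m" and c
      by (simp_all add: transpose_def vec_eq_iff)
    then show ?thesis by (simp add: subspace_def matrix_mult_linear transpose_zero)
  qed
  have "N = 0" if N: "N \<in> ?N A" and h: "h N = 0" for N
  proof -
    have "transpose A ** (N ** transpose G) = 0"
      using N by (simp add: matrix_mul_assoc matrix_mult_linear)
    from left(2)[OF this] h have "N ** transpose G = 0" by (simp add: h_def matrix_mul_assoc)
    then have "G ** transpose N = 0" by (metis matrix_transpose_mul transpose_transpose transpose_zero)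
    with right(2)[of "transpose N"] N have "transpose N = 0" by simp
    then show "N = 0" by (metis transpose_transpose transpose_zero)
  qed
  then have "inj_on h (?N A)"
    unfolding linear_injective_on_subspace_0[OF lin N_sub] by blast
  then have "inj_on h (span (?N A))"
    by (simp only: span_eq_iff[THEN iffD2, OF N_sub])
  then have "dim (?N A) = dim (h ` ?N A)" by (rule dim_image_eq[OF lin, symmetric])
  also have "\<dots> \<le> dim (?N B)" by (rule dim_subset[OF image])
  finally show ?thesis .
qed

lemma dim_tangent_eq:
  fixes A B :: "real^'n^'m"
  assumes "moore_penrose A A'" "moore_penrose B B'" "rank A = rank B"
  shows "dim (moore_penrose.tangent A A') = dim (moore_penrose.tangent B B')"
proof -
  interpret A: moore_penrose A A' by fact
  interpret B: moore_penrose B B' by fact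
  have "dim (range A.normal_part) = dim (range B.normal_part)"
    unfolding A.range_normal_part B.range_normal_part
    by (rule antisym[OF dim_biannihilator_mono[OF assms(3)]
          dim_biannihilator_mono[OF assms(3)[symmetric]]])
  then show ?thesis
    using A.dim_tangent_plus_dim_normal B.dim_tangent_plus_dim_normal by simp
qed

lemma embedded_submanifold_rank_stratum:
  "\<exists>k. embedded_submanifold k (rank_stratum r :: (real^'n^'m) set)"
proof (cases "rank_stratum r = ({} :: (real^'n^'m) set)")
  case True
  then show ?thesis by (simp add: embedded_submanifold_def)
next
  case False
  then obtain B :: "real^'n^'m" where B: "rank B = r" by (auto simp: rank_stratum_def)
  obtain B' where B': "moore_penrose B B'" using exists_moore_penrose by blast
  have "embedded_submanifold (dim (moore_penrose.tangent B B')) (rank_stratum r :: (real^'n^'m) set)"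
    unfolding embedded_submanifold_def
  proof
    fix A :: "real^'n^'m" assume "A \<in> rank_stratum r"
    then have A: "rank A = r" by (simp add: rank_stratum_def)
    obtain A' where A': "moore_penrose A A'" using exists_moore_penrose by blast
    interpret moore_penrose A A' by fact
    have dim: "dim tangent = dim (moore_penrose.tangent B B')"
      by (rule dim_tangent_eq[OF A' B']) (simp add: A B)
    show "\<exists>U V (L::(real^'n^'m) set) \<phi>. A \<in> U \<and> diffeomorphism_on U V \<phi> \<and> subspace L \<and>
        dim L = dim (moore_penrose.tangent B B') \<and> \<phi> ` (U \<inter> rank_stratum r) = V \<inter> L"
      using A_in_U chart subspace_tangent dim chart_straightens[unfolded A]
      by (intro exI[where x = U] exI[where x = tangent] exI[where x = "\<lambda>X. X + shear X"]) simp
  qed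
  then show ?thesis ..
qed

theorem theorem1p1:
  fixes r :: nat
  assumes "r \<le> CARD('m::finite)" and "CARD('m) \<le> CARD('n::finite)"
  shows "semialgebraic (rank_stratum r :: (real^'n^'m) set) \<and>
    minimal_submanifold (rank_stratum r :: (real^'n^'m) set)"
proof -
  have "mean_curvature (rank_stratum r) A = 0" if "A \<in> rank_stratum r" for A :: "real^'n^'m"
  proof -
    obtain A' where "moore_penrose A A'" using exists_moore_penrose by blast
    then show ?thesis
      using moore_penrose.mean_curvature_eq_0 that by (auto simp: rank_stratum_def)
  qed
  then show ?thesis
    using semialgebraic_rank_stratum embedded_submanifold_rank_stratum
    unfolding minimal_submanifold_def by blast
qed

end
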